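(* Let $A$ be a $4$-dimensional absolute-valued real algebra. Then: (1) $A$ satisfies $(x,x,x)=0$ if and only if $A$ is isomorphic to $\mathbb{H}$ or $\stackrel{*}{\mathbb{H}}$; likewise, $A$ satisfies $(x,x^2,x)=0$ if and only if $A$ is isomorphic to $\mathbb{H}$ or $\stackrel{*}{\mathbb{H}}$. (2) $A$ satisfies $(x,x,x^2)=0$ if and only if $A$ is isomorphic to $\mathbb{H}$ or $\mathbb{H}^*$. (3) $A$ satisfies $(x,x^2,x^2)=0$ if and only if $A$ is isomorphic to $\mathbb{H}$, $\mathbb{H}^*$ or $\mathbb{H}^*(1,i)$. (4) $A$ satisfies $(x^2,x,x)=0$ if and only if $A$ is isomorphic to $\mathbb{H}$ or ${}^*\mathbb{H}$. (5) $A$ satisfies $(x^2,x^2,x)=0$ if and only if $A$ is isomorphic to $\mathbb{H}$, ${}^*\mathbb{H}$ or ${}^*\mathbb{H}(i,1)$. (6) $A$ satisfies $(x^2,x,x^2)=0$ if and only if $A$ is isomorphic to $\mathbb{H}$, to $\stackrel{*}{\mathbb{H}}$, or to ${}^*\mathbb{H}(1,e^{i\alpha})$ or $\mathbb{H}^*(e^{i\alpha},1)$ for some $\alpha\in[0,\pi)$. (7) $A$ satisfies $(x^2,x^2,x^2)=0$ if and only if $A$ is isomorphic to $\mathbb{H}$, $\stackrel{*}{\mathbb{H}}$, ${}^*\mathbb{H}(i,1)$, ${}^*\mathbb{H}(i,i)$, $\mathbb{H}^*(1,i)$, $\mathbb{H}^*(i,i)$, or to ${}^*\mathbb{H}(1,e^{i\alpha})$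 or $\mathbb{H}^*(e^{i\alpha},1)$ for some $\alpha\in[0,\pi)$.
   Context: An algebra is a vector space with a bilinear (not necessarily associative or unital) product. A real algebra $A$ is absolute-valued if it carries a norm with $\|xy\|=\|x\|\,\|y\|$ for all $x,y$. The associator is $(x,y,z)=(xy)z-x(yz)$, and $x^2=xx$ is computed in the algebra concerned. For $p,q,r\in\{1,2\}$, an algebra satisfies $(x^p,x^q,x^r)=0$ if this equality holds for all elements $x$ of the algebra. $\mathbb{H}$ is the real quaternion algebra with canonical basis $\{1,i,j,k\}$, standard involution $x\mapsto\overline{x}$ and Euclidean norm; $e^{i\alpha}=\cos\alpha+i\sin\alpha\in\mathbb{H}$. For norm-one $a,b\in\mathbb{H}$, the principal isotopes ${}^*\mathbb{H}(a,b)$ and $\mathbb{H}^*(a,b)$ are the normed space $\mathbb{H}$ endowed respectively with the products $x\odot y=\overline{x}ayb$ and $x\odot y=axb\overline{y}$ (juxtaposition being the product of $\mathbb{H}$). Also ${}^*\mathbb{H}$, $\mathbb{H}^*$, $\stackrel{*}{\mathbb{H}}$ denote the normed space $\mathbb{H}$ with products $\overline{x}y$, $x\overline{y}$, $\overline{x}\,\overline{y}$ respectively. *)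

theory Defs
  imports "HOL-Analysis.Analysis"
begin

section \<open>Algebras given by a product on a real vector space\<close>

text \<open>
  An algebra is a real vector space together with a bilinear product, which is passed as an
  explicit argument, so that one vector space can carry several products.  No associativity
  or unit is assumed.
\<close>

definition is_norm :: "('a::real_vector \<Rightarrow> real) \<Rightarrow> bool" where
  "is_norm N \<longleftrightarrow>
     (\<forall>x. 0 \<le> N x) \<and> (\<forall>x. N x = 0 \<longleftrightarrow> x = 0) \<and>
     (\<forall>x y. N (x + y) \<le> N x + N y) \<and> (\<forall>c x. N (c *\<^sub>R x) = \<bar>c\<bar> * N x)"

definition absolute_valued :: "('a::real_vector \<Rightarrow> 'a \<Rightarrow> 'a) \<Rightarrow> bool" where
  "absolute_valued m \<longleftrightarrow>
     bilinear m \<and> (\<exists>N. is_norm N \<and> (\<forall>x y. N (m x y) = N x * N y))"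

definition associator :: "('a::real_vector \<Rightarrow> 'a \<Rightarrow> 'a) \<Rightarrow> 'a \<Rightarrow> 'a \<Rightarrow> 'a \<Rightarrow> 'a" where
  "associator m x y z = m (m x y) z - m x (m y z)"

definition sq :: "('a \<Rightarrow> 'a \<Rightarrow> 'a) \<Rightarrow> 'a \<Rightarrow> 'a" where
  "sq m x = m x x"

definition alg_isomorphic ::
  "('a::real_vector \<Rightarrow> 'a \<Rightarrow> 'a) \<Rightarrow> ('b::real_vector \<Rightarrow> 'b \<Rightarrow> 'b) \<Rightarrow> bool" where
  "alg_isomorphic m m' \<longleftrightarrow>
     (\<exists>f. linear f \<and> bij f \<and> (\<forall>x y. f (m x y) = m' (f x) (f y)))"


section \<open>Quaternions\<close>

datatype quat = Quat (qre: real) (qim1: real) (qim2: real) (qim3: real)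

lemma quat_eq_iff:
  "x = y \<longleftrightarrow> qre x = qre y \<and> qim1 x = qim1 y \<and> qim2 x = qim2 y \<and> qim3 x = qim3 y"
  by (cases x; cases y) simp

instantiation quat :: real_algebra_1
begin

definition zero_quat :: quat where "0 = Quat 0 0 0 0"

definition one_quat :: quat where "1 = Quat 1 0 0 0"

definition plus_quat :: "quat \<Rightarrow> quat \<Rightarrow> quat" where
  "x + y = Quat (qre x + qre y) (qim1 x + qim1 y) (qim2 x + qim2 y) (qim3 x + qim3 y)"

definition minus_quat :: "quat \<Rightarrow> quat \<Rightarrow> quat" where
  "x - y = Quat (qre x - qre y) (qim1 x - qim1 y) (qim2 x - qim2 y) (qim3 x - qim3 y)"

definition uminus_quat :: "quat \<Rightarrow> quat" where
  "- x = Quat (- qre x) (- qim1 x) (- qim2 x) (- qim3 x)"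

definition scaleR_quat :: "real \<Rightarrow> quat \<Rightarrow> quat" where
  "c *\<^sub>R x = Quat (c * qre x) (c * qim1 x) (c * qim2 x) (c * qim3 x)"

definition times_quat :: "quat \<Rightarrow> quat \<Rightarrow> quat" where
  "x * y = Quat
     (qre x * qre y - qim1 x * qim1 y - qim2 x * qim2 y - qim3 x * qim3 y)
     (qre x * qim1 y + qim1 x * qre y + qim2 x * qim3 y - qim3 x * qim2 y)
     (qre x * qim2 y - qim1 x * qim3 y + qim2 x * qre y + qim3 x * qim1 y)
     (qre x * qim3 y + qim1 x * qim2 y - qim2 x * qim1 y + qim3 x * qre y)"

instance
  by standard
    (simp_all add: quat_eq_iff zero_quat_def one_quat_def plus_quat_def minus_quat_def
      uminus_quat_def scaleR_quat_def times_quat_def algebra_simps)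

end

lemmas quat_op_defs = zero_quat_def one_quat_def plus_quat_def minus_quat_def
  uminus_quat_def scaleR_quat_def times_quat_def

instantiation quat :: real_normed_algebra_1
begin

definition norm_quat_def:
  "norm (x::quat) = sqrt ((qre x)\<^sup>2 + (qim1 x)\<^sup>2 + (qim2 x)\<^sup>2 + (qim3 x)\<^sup>2)"

definition sgn_quat_def:
  "sgn (x::quat) = x /\<^sub>R norm x"

definition dist_quat_def:
  "dist (x::quat) y = norm (x - y)"

definition uniformity_quat_def:
  "(uniformity :: (quat \<times> quat) filter) =
     (INF e\<in>{0 <..}. principal {(x, y). dist x y < e})"

definition open_quat_def:
  "open (U :: quat set) \<longleftrightarrow> (\<forall>x\<in>U. eventually (\<lambda>(x', y). x' = x \<longrightarrow> y \<in> U) uniformity)"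

lemma norm_quat_mult: "norm (x * y) = norm x * norm (y::quat)"
  unfolding norm_quat_def real_sqrt_mult [symmetric]
  by (rule arg_cong [of _ _ sqrt])
    (simp add: times_quat_def power2_eq_square, simp add: algebra_simps)

instance
proof
  fix x y :: quat and c :: real
  show "norm x = 0 \<longleftrightarrow> x = 0"
    by (simp add: norm_quat_def quat_eq_iff zero_quat_def add_nonneg_eq_0_iff)
  have norm_pair: "norm z = norm (Complex (qre z) (qim1 z), Complex (qim2 z) (qim3 z))"
    for z :: quat
    by (simp add: norm_quat_def norm_Pair complex_norm add.assoc)
  show "norm (x + y) \<le> norm x + norm y"
    unfolding norm_pair
    using norm_triangle_ineq [of "(Complex (qre x) (qim1 x), Complex (qim2 x) (qim3 x))"
        "(Complex (qre y) (qim1 y), Complex (qim2 y) (qim3 y))"]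
    by (simp add: plus_quat_def complex_add)
  have "norm (c *\<^sub>R x) =
      sqrt (c\<^sup>2 * ((qre x)\<^sup>2 + (qim1 x)\<^sup>2 + (qim2 x)\<^sup>2 + (qim3 x)\<^sup>2))"
    by (simp add: norm_quat_def scaleR_quat_def power_mult_distrib distrib_left)
  then show "norm (c *\<^sub>R x) = \<bar>c\<bar> * norm x"
    by (simp add: norm_quat_def real_sqrt_mult)
  show "norm (x * y) \<le> norm x * norm y"
    by (simp add: norm_quat_mult)
  show "norm (1::quat) = 1"
    by (simp add: norm_quat_def one_quat_def)
qed (simp_all add: sgn_quat_def dist_quat_def uniformity_quat_def open_quat_def)

end

definition qi :: quat where "qi = Quat 0 1 0 0"
definition qj :: quat where "qj = Quat 0 0 1 0"
definition qk :: quat where "qk = Quat 0 0 0 1"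

lemma quat_basis_mult:
  "qi * qi = -1" "qj * qj = -1" "qk * qk = -1"
  "qi * qj = qk" "qj * qk = qi" "qk * qi = qj"
  "qj * qi = - qk" "qk * qj = - qi" "qi * qk = - qj"
  by (simp_all add: qi_def qj_def qk_def quat_op_defs)

lemma quat_basis_expansion:
  "x = qre x *\<^sub>R 1 + qim1 x *\<^sub>R qi + qim2 x *\<^sub>R qj + qim3 x *\<^sub>R qk"
  by (simp add: quat_eq_iff qi_def qj_def qk_def quat_op_defs)

definition qcnj :: "quat \<Rightarrow> quat" where
  "qcnj x = Quat (qre x) (- qim1 x) (- qim2 x) (- qim3 x)"

definition qcis :: "real \<Rightarrow> quat" where
  "qcis \<alpha> = of_real (cos \<alpha>) + qi * of_real (sin \<alpha>)"

lemma norm_qcnj [simp]: "norm (qcnj x) = norm x"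
  by (simp add: norm_quat_def qcnj_def)

lemma norm_qi [simp]: "norm qi = 1"
  by (simp add: norm_quat_def qi_def)

lemma qcis_eq_Quat: "qcis \<alpha> = Quat (cos \<alpha>) (sin \<alpha>) 0 0"
  by (simp add: qcis_def of_real_def qi_def quat_op_defs)

lemma norm_qcis [simp]: "norm (qcis \<alpha>) = 1"
  by (simp add: qcis_eq_Quat norm_quat_def)


section \<open>Isotopes of the quaternions\<close>

text \<open>
  The first two products, for parameters \<open>a\<close>, \<open>b\<close> of norm one, are those of the principal
  isotopes \<open>*H(a,b)\<close> and \<open>H*(a,b)\<close>; the other three are those of \<open>*H\<close>, \<open>H*\<close> and of \<open>H\<close> with
  a star on top.  The product of \<open>H\<close> itself is the ring multiplication of \<^typ>\<open>quat\<close>.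
\<close>

definition lstar_isotope :: "quat \<Rightarrow> quat \<Rightarrow> quat \<Rightarrow> quat \<Rightarrow> quat" where
  "lstar_isotope a b x y = qcnj x * a * y * b"

definition rstar_isotope :: "quat \<Rightarrow> quat \<Rightarrow> quat \<Rightarrow> quat \<Rightarrow> quat" where
  "rstar_isotope a b x y = a * x * b * qcnj y"

definition lstar_mult :: "quat \<Rightarrow> quat \<Rightarrow> quat" where
  "lstar_mult x y = qcnj x * y"

definition rstar_mult :: "quat \<Rightarrow> quat \<Rightarrow> quat" where
  "rstar_mult x y = x * qcnj y"

definition topstar_mult :: "quat \<Rightarrow> quat \<Rightarrow> quat" where
  "topstar_mult x y = qcnj x * qcnj y"

lemma is_norm_norm: "is_norm (norm :: 'a::real_normed_vector \<Rightarrow> real)"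
  by (simp add: is_norm_def norm_triangle_ineq)

lemma linear_qcnj: "linear qcnj"
  by (rule linearI) (simp_all add: qcnj_def quat_op_defs)

lemma absolute_valued_lstar_isotope:
  assumes "norm a = 1" "norm b = 1"
  shows "absolute_valued (lstar_isotope a b)"
  unfolding absolute_valued_def bilinear_def
  using assms is_norm_norm
  by (auto intro!: linearI exI [of _ norm]
      simp: lstar_isotope_def linear_add [OF linear_qcnj] linear_scale [OF linear_qcnj]
        norm_quat_mult algebra_simps)

lemma absolute_valued_rstar_isotope:
  assumes "norm a = 1" "norm b = 1"
  shows "absolute_valued (rstar_isotope a b)"
  unfolding absolute_valued_def bilinear_def
  using assms is_norm_norm
  by (auto intro!: linearI exI [of _ norm]
      simp: rstar_isotope_def linear_add [OF linear_qcnj] linear_scale [OF linear_qcnj]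
        norm_quat_mult algebra_simps)

end

theory Submission
  imports Defs "HOL-Computational_Algebra.Fundamental_Theorem_Algebra"
begin

text \<open>
  If \<open>a\<close>, \<open>b\<close> have norm one, passing to the product \<open>x b \<odot> a y = x y\<close> keeps the norm
  multiplicative and makes \<open>a b\<close> a unit.  In a finite-dimensional unital absolute-valued algebra,
  left multiplication by \<open>x - t\<close> scales the norm by \<open>N (x - t)\<close>, so \<open>N (x - t) = |\<mu> - t|\<close> for
  every complex eigenvalue \<open>\<mu>\<close> of left multiplication by \<open>x\<close>.  Hence the norm is Euclidean on all
  planes through the unit, and since every vector of norm one is the unit of some isotope,
  the parallelogram law holds.  In dimension four the unital isotope is then the algebra of
  quaternions, and the original product is \<open>f x * g y\<close> with linear isometries \<open>f\<close>, \<open>g\<close> of the form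
  \<open>x \<mapsto> a x b\<close> or \<open>x \<mapsto> a x\<^sup>* b\<close>.  This leaves four two-parameter families of products.

  For each family, conjugation makes the first parameter complex.  An identity evaluated on complex
  \<open>x\<close>, which commute with the first parameter, mostly cancels and nearly always forces the second
  parameter to be complex too; the remaining cases are decided by a few non-complex test points
  such as \<open>\<j>\<close> and \<open>1 + \<j>\<close>.
\<close>

section \<open>Complex eigenvectors and norm similarities\<close>

text \<open>The space carries no topology of its own, so eigenvalues come from an annihilating
  polynomial. The opposite product, followed by conjugation, swaps \<open>lstar_isotope\<close> with
  \<open>rstar_isotope\<close> and preserves the other two families, so every result also settles
  the reversed exponents. In \<open>id_isotope\<close> and \<open>topstar_isotope\<close> squaring
  is onto; exponents (2,2,2) then amount to (1,1,1), and only the algebra without parameters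
  survives. In \<open>lstar_isotope a b\<close> the square of x is conj(x) a x b, and the real part
  of conj(x) a x has a fixed sign: squaring is far from onto, so identities tested only on squares
  leave room for more algebras. For \<open>a = 1\<close> all squares are real multiples of
  \<open>b\<close>, hence a whole family with free \<open>b\<close>; for \<open>a = qi\<close> the
  factor conj(x) a x is purely imaginary, hence the isolated algebras. Changing the sign of a
  parameter gives an isomorphic algebra, which cuts the circle of parameters e^(i alpha) down to the
  interval [0, pi).\<close>

lemma finite_basis_of_dim_pos:
  assumes "dim (UNIV :: 'a::real_vector set) > 0"
  obtains B :: "'a::real_vector set" where "finite B" "independent B" "span B = UNIV"
    "card B = dim (UNIV :: 'a::real_vector set)"
proof -
  obtain B :: "'a set" where "independent B" "UNIV \<subseteq> span B" "card B = dim (UNIV :: 'a set)"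
    by (rule real_vector.basis_exists [of "UNIV :: 'a set"])
  \<comment> \<open>\<open>dim\<close> is the cardinality of a basis, hence 0 for an infinite one;
    its positivity is how finite dimension enters.\<close>
  moreover from this assms have "finite B"
    by (simp add: card_ge_0_finite)
  ultimately show thesis
    by (intro that [of B] top_le)
qed

lemma nonzero_of_dim_pos:
  assumes "dim (UNIV :: 'a::real_vector set) > 0"
  obtains x :: "'a::real_vector" where "x \<noteq> 0"
proof -
  obtain B :: "'a set" where "independent B" "card B = dim (UNIV :: 'a set)"
    using finite_basis_of_dim_pos [OF assms] by metis
  with assms obtain b where "b \<in> B" by fastforce
  with \<open>independent B\<close> that show thesis by (metis real_vector.dependent_zero)
qed

lemma independent_card_dim_spans:
  fixes S :: "'a::real_vector set"
  assumes "dim (UNIV :: 'a set) > 0" "independent S" "card S = dim (UNIV :: 'a set)"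
  shows "span S = UNIV"
proof (rule ccontr)
  assume "span S \<noteq> UNIV"
  then obtain x where x: "x \<notin> span S" by blast
  obtain B :: "'a set" where B: "finite B" "span B = UNIV" "card B = dim (UNIV :: 'a set)"
    using finite_basis_of_dim_pos [OF assms(1)] by metis
  have fin: "finite S" using assms by (auto intro: card_ge_0_finite)
  have "x \<notin> S" using x by (meson real_vector.span_base)
  then have "independent (insert x S)"
    using assms(2) x by (simp add: real_vector.independent_insert)
  from real_vector.independent_span_bound [OF B(1) this]
  have "card (insert x S) \<le> card B" using B(2) by simp
  with \<open>x \<notin> S\<close> fin B(3) assms(3) show False by simp
qed

lemma inj_linear_imp_bij:
  fixes f :: "'a::real_vector \<Rightarrow> 'a"
  assumes d: "dim (UNIV :: 'a set) > 0" and f: "linear f" and inj: "\<And>x. f x = 0 \<Longrightarrow> x = 0"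
  shows "bij f"
proof -
  have i: "inj f" using f inj linear_injective_0 by blast
  obtain B :: "'a set" where B: "independent B" "card B = dim (UNIV :: 'a set)"
    using finite_basis_of_dim_pos [OF d] by metis
  have "independent (f ` B)"
    using linear_independent_injective_image [OF f B(1)] i by (metis inj_on_subset subset_UNIV)
  moreover have "card (f ` B) = dim (UNIV :: 'a set)"
    using B(2) i by (metis card_image inj_on_subset subset_UNIV)
  ultimately have "span (f ` B) = UNIV"
    by (intro independent_card_dim_spans [OF d])
  then have "f ` span B = UNIV" using linear_span_image [OF f] by metis
  then have "surj f" by blast
  with i show ?thesis by (simp add: bij_def)
qed

text \<open>The n + 1 vectors are taken as a family because two of them may coincide: a repetition
  is a relation that dependence of the image set does not see.\<close>

lemma linear_relation_of_dim_lt: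
  fixes f :: "nat \<Rightarrow> 'a::real_vector"
  assumes d: "dim (UNIV :: 'a set) > 0" and n: "n \<ge> dim (UNIV :: 'a set)"
  obtains c where "\<exists>i\<le>n. c i \<noteq> 0" "(\<Sum>i\<le>n. c i *\<^sub>R f i) = 0"
proof (cases "inj_on f {..n}")
  case True
  obtain B :: "'a set" where B: "finite B" "span B = UNIV" "card B = dim (UNIV :: 'a set)"
    using finite_basis_of_dim_pos [OF d] by metis
  have "card (f ` {..n}) = Suc n" using True by (simp add: card_image)
  then have "dependent (f ` {..n})"
    using real_vector.independent_span_bound [OF B(1), of "f ` {..n}"] B n by fastforce
  then obtain u where u: "\<exists>v\<in>f ` {..n}. u v \<noteq> 0" "(\<Sum>v\<in>f ` {..n}. u v *\<^sub>R v) = 0"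
    using real_vector.dependent_finite [of "f ` {..n}"] by auto
  show thesis
  proof (rule that [of "u \<circ> f"])
    show "\<exists>i\<le>n. (u \<circ> f) i \<noteq> 0" using u(1) by auto
    show "(\<Sum>i\<le>n. (u \<circ> f) i *\<^sub>R f i) = 0"
      using u(2) by (simp add: sum.reindex [OF True])
  qed
next
  case False
  then obtain i j where ij: "i \<le> n" "j \<le> n" "i \<noteq> j" "f i = f j"
    by (auto simp: inj_on_def)
  show thesis
  proof (rule that [of "\<lambda>k. if k = i then 1 else if k = j then -1 else 0"])
    show "\<exists>k\<le>n. (if k = i then 1 else if k = j then -1 else (0::real)) \<noteq> 0"
      using ij by auto
    have "(\<Sum>k\<le>n. (if k = i then 1 else if k = j then -1 else (0::real)) *\<^sub>R f k) =
      (\<Sum>k\<le>n. (if k = i then f i else 0) - (if k = j then f j else 0))"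
      using ij by (intro sum.cong) auto
    also have "\<dots> = 0" using ij by (simp add: sum_subtractf)
    finally show "(\<Sum>k\<le>n. (if k = i then 1 else if k = j then -1 else (0::real)) *\<^sub>R f k) = 0" .
  qed
qed

text \<open>Pairs \<open>(v, w)\<close> stand for \<open>v + \<i> w\<close> in the complexification.\<close>

definition cscale :: "complex \<Rightarrow> 'a::real_vector \<times> 'a \<Rightarrow> 'a \<times> 'a" where
  "cscale z u = (Re z *\<^sub>R fst u - Im z *\<^sub>R snd u, Im z *\<^sub>R fst u + Re z *\<^sub>R snd u)"

text \<open>Horner's scheme for p(T) u, where \<open>map_prod T T\<close> is the complexification of
  \<open>T\<close>.\<close>

definition poly_op :: "('a \<Rightarrow> 'a) \<Rightarrow> complex poly \<Rightarrow> 'a::real_vector \<times> 'a \<Rightarrow> 'a \<times> 'a" where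
  "poly_op T p u = fold_coeffs (\<lambda>c r. cscale c u + map_prod T T r) p 0"

lemma cscale_add: "cscale (c + d) u = cscale c u + cscale d u"
  by (simp add: cscale_def algebra_simps)

lemma cscale_mult: "cscale (c * d) u = cscale c (cscale d u)"
  by (simp add: cscale_def algebra_simps)

lemma cscale_add_right: "cscale c (u + v) = cscale c u + cscale c v"
  by (simp add: cscale_def algebra_simps)

lemma cscale_0 [simp]: "cscale 0 u = 0" "cscale c 0 = 0"
  by (simp_all add: cscale_def zero_prod_def)

lemma poly_op_0 [simp]: "poly_op T 0 u = 0"
  by (simp add: poly_op_def)

lemma map_prod_linear:
  assumes "linear T"
  shows "map_prod T T 0 = 0" "map_prod T T (u + v) = map_prod T T u + map_prod T T v"
    "map_prod T T (cscale c u) = cscale c (map_prod T T u)"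
  using assms
  by (simp_all add: zero_prod_def cscale_def linear_0 linear_add linear_diff linear_scale prod_eq_iff)

lemma poly_op_pCons:
  assumes "linear T"
  shows "poly_op T (pCons c p) u = cscale c u + map_prod T T (poly_op T p u)"
  \<comment> \<open>\<open>pCons 0 0\<close> is the zero polynomial and has no coefficients to fold;
    the right-hand side then vanishes because \<open>T 0 = 0\<close>.\<close>
  using assms
  by (cases "p = 0 \<and> c = 0") (auto simp: poly_op_def map_prod_linear fold_coeffs_def)

lemma poly_op_add:
  assumes "linear T"
  shows "poly_op T (p + q) u = poly_op T p u + poly_op T q u"
  by (induction p q rule: poly_induct2)
    (simp_all add: poly_op_pCons map_prod_linear assms cscale_add)

lemma poly_op_smult:
  assumes "linear T"
  shows "poly_op T (smult c p) u = cscale c (poly_op T p u)"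
  by (induction p)
    (simp_all add: poly_op_pCons map_prod_linear assms cscale_mult cscale_add_right)

lemma poly_op_monom:
  assumes "linear T"
  shows "poly_op T (monom c n) u = cscale c ((map_prod T T ^^ n) u)"
  by (induction n)
    (simp_all add: monom_0 monom_Suc poly_op_pCons map_prod_linear assms)

lemma poly_op_sum:
  assumes "linear T"
  shows "poly_op T (sum p A) u = (\<Sum>i\<in>A. poly_op T (p i) u)"
  by (induction A rule: infinite_finite_induct) (simp_all add: poly_op_add assms)

text \<open>Split off a root: p = (X - r) q. Either q(T) u = 0 and the degree has dropped, or q(T) u
  is itself an eigenvector for r. In degree 0 a nonzero constant cannot annihilate
  \<open>u\<close>.\<close>

lemma eigenvector_of_poly_op_eq_0:
  assumes T: "linear T" and "poly_op T p u = 0" "p \<noteq> 0" "u \<noteq> 0"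
  shows "\<exists>z v. v \<noteq> 0 \<and> map_prod T T v = cscale z v"
  using assms(2-)
proof (induction "degree p" arbitrary: p)
  case 0
  then obtain c where c: "p = [:c:]" "c \<noteq> 0" by (metis degree_0_id pCons_0_0)
  have "u = cscale (inverse c * c) u" using c by (simp add: cscale_def)
  also have "\<dots> = cscale (inverse c) (poly_op T p u)"
    using c T by (simp only: cscale_mult) (simp add: poly_op_pCons map_prod_linear)
  finally show ?case using 0 by simp
next
  case (Suc n)
  then have "\<not> constant (poly p)" by (simp add: constant_degree)
  then obtain r where "poly p r = 0" using fundamental_theorem_of_algebra by blast
  then obtain q where q: "p = [:- r, 1:] * q" by (metis dvdE poly_eq_0_iff_dvd)
  then have "q \<noteq> 0" "degree q = n"
    using Suc.prems Suc.hyps(2) by (auto simp: degree_mult_eq simp del: mult_pCons_left mult_pCons_right)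
  have "p = smult (- r) q + pCons 0 q" by (simp add: q)
  then have "cscale (- r) (poly_op T q u) + map_prod T T (poly_op T q u) = 0"
    using Suc.prems(1)
    by (simp only: poly_op_add [OF T] poly_op_smult [OF T] poly_op_pCons [OF T] cscale_0 add_0)
  then have "map_prod T T (poly_op T q u) = cscale r (poly_op T q u)"
    by (simp add: cscale_def prod_eq_iff algebra_simps add_eq_0_iff)
  then show ?case
    using Suc.hyps(1) [of q] \<open>degree q = n\<close> \<open>q \<noteq> 0\<close> Suc.prems(3) by metis
qed

text \<open>The iterates of one nonzero vector are linearly dependent, which gives a polynomial in
  \<open>T\<close> that annihilates it. The conclusion is T (v + i w) = (alpha + i beta)(v + i w),
  split into real and imaginary parts.\<close>

lemma complex_eigenvector_exists:
  fixes T :: "'a::real_vector \<Rightarrow> 'a"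
  assumes d: "dim (UNIV :: 'a set) > 0" and T: "linear T"
  obtains \<alpha> \<beta> v w where "v \<noteq> 0 \<or> w \<noteq> 0"
    "T v = \<alpha> *\<^sub>R v - \<beta> *\<^sub>R w" "T w = \<beta> *\<^sub>R v + \<alpha> *\<^sub>R w"
proof -
  let ?n = "dim (UNIV :: 'a set)"
  obtain x :: 'a where x: "x \<noteq> 0" by (rule nonzero_of_dim_pos [OF d])
  obtain c where c: "\<exists>i\<le>?n. c i \<noteq> 0" "(\<Sum>i\<le>?n. c i *\<^sub>R (T ^^ i) x) = 0"
    using linear_relation_of_dim_lt [OF d order_refl, of "\<lambda>i. (T ^^ i) x"] by metis
  define p where "p = (\<Sum>i\<le>?n. monom (complex_of_real (c i)) i)"
  have coeff: "coeff p i = of_real (c i)" if "i \<le> ?n" for i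
    using that by (simp add: p_def coeff_sum)
  have "p \<noteq> 0" using c(1) coeff by (metis coeff_0 of_real_eq_0_iff)
  moreover have "poly_op T p (x, 0) = 0"
  proof -
    have it: "(map_prod T T ^^ i) (x, 0) = ((T ^^ i) x, 0)" for i
      using T by (induction i) (simp_all add: linear_0)
    have "poly_op T p (x, 0) = (\<Sum>i\<le>?n. (c i *\<^sub>R (T ^^ i) x, 0))"
      by (simp add: p_def poly_op_sum poly_op_monom T it cscale_def)
    also have "\<dots> = (\<Sum>i\<le>?n. c i *\<^sub>R (T ^^ i) x, 0)"
      by (simp add: sum_prod)
    finally show ?thesis using c(2) by (simp add: zero_prod_def)
  qed
  moreover have "(x, 0) \<noteq> 0" using x by (simp add: zero_prod_def)
  ultimately obtain z v where "v \<noteq> 0" "map_prod T T v = cscale z v"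
    using eigenvector_of_poly_op_eq_0 [OF T] by blast
  then show thesis
    by (intro that [of "fst v" "snd v" "Re z" "Im z"])
      (auto simp: cscale_def prod_eq_iff)
qed

lemma is_normD:
  assumes "is_norm N"
  shows "0 \<le> N x" "N x = 0 \<longleftrightarrow> x = 0" "N (x + y) \<le> N x + N y" "N (c *\<^sub>R x) = \<bar>c\<bar> * N x"
  using assms by (simp_all add: is_norm_def)

text \<open>
  If \<open>T - l\<close> scales \<open>N\<close> by \<open>\<rho>\<close>, then it scales by \<open>\<rho>\<close> also the norm
  \<open>v + \<i> w \<mapsto> SUP t. N (Re (e\<^sup>\<i>\<^sup>t (v + \<i> w)))\<close> of the complexification,
  so that \<open>\<rho>\<close> is the distance of \<open>l\<close> from every complex eigenvalue.
\<close>

lemma similarity_eigenvalue: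
  fixes T :: "'a::real_vector \<Rightarrow> 'a"
  assumes N: "is_norm N" and T: "linear T" and nz: "v \<noteq> 0 \<or> w \<noteq> 0"
    and ev: "T v = \<alpha> *\<^sub>R v - \<beta> *\<^sub>R w" "T w = \<beta> *\<^sub>R v + \<alpha> *\<^sub>R w"
    and sc: "\<And>x. N (T x) = \<rho> * N x"
  shows "\<rho>\<^sup>2 = \<alpha>\<^sup>2 + \<beta>\<^sup>2"
proof -
  define u where "u t = cos t *\<^sub>R v - sin t *\<^sub>R w" for t :: real
  define M where "M = (SUP t. N (u t))"
  have bd: "N (u t) \<le> N v + N w" for t
  proof -
    have "N (u t) = N (cos t *\<^sub>R v + (- sin t) *\<^sub>R w)" by (simp add: u_def)
    also have "\<dots> \<le> N (cos t *\<^sub>R v) + N ((- sin t) *\<^sub>R w)" by (rule is_normD [OF N])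
    also have "\<dots> = \<bar>cos t\<bar> * N v + \<bar>sin t\<bar> * N w"
      by (simp only: is_normD(4) [OF N] abs_minus_cancel)
    also have "\<dots> \<le> 1 * N v + 1 * N w"
      using N by (intro add_mono mult_right_mono) (auto simp: is_norm_def)
    finally show ?thesis by simp
  qed
  then have bdd: "bdd_above (range (\<lambda>t. N (u t)))" by (auto intro!: bdd_aboveI)
  have le: "N (u t) \<le> M" for t unfolding M_def by (intro cSUP_upper bdd) auto
  have "M > 0"
  proof -
    \<comment> \<open>\<open>u 0\<close> is \<open>v\<close> and \<open>u (pi/2)\<close> is
      \<open>- w\<close>.\<close>
    have "N (u 0) > 0 \<or> N (u (pi/2)) > 0"
      using nz N by (auto simp: u_def is_norm_def less_le)
    then show ?thesis using le less_le_trans by blast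
  qed
  define r where "r = sqrt (\<alpha>\<^sup>2 + \<beta>\<^sup>2)"
  obtain s where s: "\<alpha> = r * cos s" "\<beta> = r * sin s"
  proof -
    have "Complex \<alpha> \<beta> = rcis r (Arg (Complex \<alpha> \<beta>))"
      by (metis rcis_cmod_Arg complex_norm r_def)
    then show thesis using that [of "Arg (Complex \<alpha> \<beta>)"]
      by (metis Re_rcis Im_rcis complex.sel)
  qed
  \<comment> \<open>In polar form the eigenvalue is r e^(is): \<open>T\<close> scales by
    \<open>r\<close> and shifts the phase by \<open>s\<close>, and a supremum over all phases does
    not see the shift.\<close>
  have Tu: "T (u t) = r *\<^sub>R u (s + t)" for t
    using T by (simp add: u_def linear_diff linear_scale ev s cos_add sin_add algebra_simps)
  have r0: "r \<ge> 0" by (simp add: r_def)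
  have eq: "\<rho> * N (u t) = r * N (u (s + t))" for t
    using sc [of "u t"] N r0 unfolding Tu by (simp add: is_norm_def)
  have rho0: "\<rho> \<ge> 0"
  proof -
    obtain x :: 'a where "x \<noteq> 0" using nz by (metis (full_types))
    then have "N x > 0" using is_normD(1,2) [OF N, of x] by simp
    moreover have "\<rho> * N x \<ge> 0" using is_normD(1) [OF N, of "T x"] by (simp add: sc)
    ultimately show ?thesis by (simp add: zero_le_mult_iff)
  qed
  have "\<rho> * M = r * M"
  proof (rule antisym)
    have "\<rho> * N (u t) \<le> r * M" for t
      unfolding eq using le r0 by (intro mult_left_mono) auto
    then show "\<rho> * M \<le> r * M"
    proof (cases "\<rho> = 0")
      case False
      then have "\<rho> > 0" using rho0 by simp
      moreover from this have "M \<le> (r * M) / \<rho>"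
        unfolding M_def using \<open>\<And>t. \<rho> * N (u t) \<le> r * M\<close>
        by (intro cSUP_least) (auto simp: field_simps M_def)
      ultimately show ?thesis by (simp add: field_simps)
    qed (use r0 \<open>M > 0\<close> in simp)
    have "r * N (u t) \<le> \<rho> * M" for t
      using eq [of "t - s"] mult_left_mono [OF le [of "t - s"] rho0] by simp
    then show "r * M \<le> \<rho> * M"
    proof (cases "r = 0")
      case False
      then have "r > 0" using r0 by simp
      moreover from this have "M \<le> (\<rho> * M) / r"
        unfolding M_def using \<open>\<And>t. r * N (u t) \<le> \<rho> * M\<close>
        by (intro cSUP_least) (auto simp: field_simps M_def)
      ultimately show ?thesis by (simp add: field_simps)
    qed (use rho0 \<open>M > 0\<close> in simp)
  qed
  with \<open>M > 0\<close> have "\<rho> = r" by simp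
  then show ?thesis by (simp add: r_def)
qed

section \<open>Four-dimensional absolute-valued algebras are isotopes of the quaternions\<close>

lemma linear_inv:
  assumes "linear f" "bij f"
  shows "linear (inv f)"
proof (rule linearI)
  have s: "f (inv f x) = x" for x using assms(2) by (simp add: bij_is_surj surj_f_inv_f)
  show "inv f (x + y) = inv f x + inv f y" for x y
    using assms(2) by (intro inv_f_eq) (simp_all add: bij_is_inj linear_add [OF assms(1)] s)
  show "inv f (c *\<^sub>R x) = c *\<^sub>R inv f x" for c x
    using assms(2) by (intro inv_f_eq) (simp_all add: bij_is_inj linear_scale [OF assms(1)] s)
qed

lemma is_norm_0 [simp]: "is_norm N \<Longrightarrow> N 0 = 0"
  by (simp add: is_normD)

lemma is_norm_normalize:
  assumes "is_norm N" "x \<noteq> 0"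
  shows "N (inverse (N x) *\<^sub>R x) = 1"
  using assms by (simp add: is_normD)

section \<open>Absolute-valued algebras and their unital isotopes\<close>

locale absolute_valued_dim4 =
  fixes m :: "'a::real_vector \<Rightarrow> 'a \<Rightarrow> 'a" and N :: "'a \<Rightarrow> real"
  assumes dim4: "dim (UNIV :: 'a set) = 4"
    and bilin: "bilinear m"
    and norm: "is_norm N"
    and mult: "N (m x y) = N x * N y"
begin

lemma linear_left: "linear (\<lambda>x. m x y)" and linear_right: "linear (m x)"
  using bilin by (simp_all add: bilinear_def)

lemma unit_exists: obtains a where "N a = 1"
proof -
  obtain x :: 'a where "x \<noteq> 0"
    by (rule nonzero_of_dim_pos) (use dim4 in auto)
  then show thesis using is_norm_normalize [OF norm] that by blast
qed

lemma eq_0_iff: "m x y = 0 \<longleftrightarrow> x = 0 \<or> y = 0"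
  by (metis mult mult_eq_0_iff is_normD(2) [OF norm])

lemma bij_mult:
  assumes "a \<noteq> 0" shows "bij (m a)" "bij (\<lambda>x. m x a)"
  using assms dim4
  by (auto intro!: inj_linear_imp_bij linear_left linear_right simp: eq_0_iff)

definition isot :: "'a \<Rightarrow> 'a \<Rightarrow> 'a \<Rightarrow> 'a \<Rightarrow> 'a" where
  "isot a b x y = m (inv (\<lambda>x. m x b) x) (inv (m a) y)"

lemma isot_mult:
  assumes "a \<noteq> 0" "b \<noteq> 0"
  shows "isot a b (m x b) (m a y) = m x y"
  using bij_mult [OF assms(1)] bij_mult [OF assms(2)]
  by (simp add: isot_def inv_f_f bij_is_inj inv_f_eq)

lemma isot_unital:
  assumes "N a = 1" "N b = 1"
  shows "absolute_valued_dim4 (isot a b) N" "isot a b (m a b) x = x" "isot a b x (m a b) = x"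
proof -
  have nz: "a \<noteq> 0" "b \<noteq> 0" using assms norm by auto
  note bij = bij_mult(1) [OF nz(1)] bij_mult(2) [OF nz(2)]
  \<comment> \<open>Every vector is some z b and some a z; on such products \<open>isot_mult\<close>
    removes the inverses, so each law is inherited from \<open>m\<close>.\<close>
  have R: "\<exists>z. x = m z b" and L: "\<exists>z. x = m a z" for x
    using bij by (metis bij_pointE)+
  show "isot a b (m a b) x = x" "isot a b x (m a b) = x"
    using R [of x] L [of x] isot_mult [OF nz] by auto
  show "absolute_valued_dim4 (isot a b) N"
  proof
    show "bilinear (isot a b)"
      unfolding bilinear_def
    proof (intro conjI allI)
      fix x
      obtain z where z: "x = m z b" using R by blast
      show "linear (isot a b x)"
      proof (rule linearI)
        fix y y' c
        obtain w w' where w: "y = m a w" "y' = m a w'" using L by metis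
        show "isot a b x (y + y') = isot a b x y + isot a b x y'"
          by (simp add: z w isot_mult [OF nz] flip: linear_add [OF linear_right])
        show "isot a b x (c *\<^sub>R y) = c *\<^sub>R isot a b x y"
          by (simp add: z w isot_mult [OF nz] flip: linear_scale [OF linear_right])
      qed
    next
      fix y
      obtain w where w: "y = m a w" using L by blast
      show "linear (\<lambda>x. isot a b x y)"
      proof (rule linearI)
        fix x x' c
        obtain z z' where z: "x = m z b" "x' = m z' b" using R by metis
        show "isot a b (x + x') y = isot a b x y + isot a b x' y"
          by (simp add: z w isot_mult [OF nz] flip: linear_add [OF linear_left])
        show "isot a b (c *\<^sub>R x) y = c *\<^sub>R isot a b x y"
          by (simp add: z w isot_mult [OF nz] flip: linear_scale [OF linear_left])
      qed
    qed
    fix x y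
    obtain z w where "x = m z b" "y = m a w" using R L by metis
    then show "N (isot a b x y) = N x * N y"
      using assms by (simp add: isot_mult [OF nz] mult)
  qed (use dim4 norm in auto)
qed

text \<open>One eigenvector serves every \<open>t\<close>: since \<open>e\<close> acts as the
  identity, it is also an eigenvector of left multiplication by x - t e, with the eigenvalue shifted
  by \<open>t\<close>. So the square of N (x - t e) is quadratic in \<open>t\<close>, and
  \<open>p\<close> is the real part of the eigenvalue.\<close>

lemma unital_plane_euclidean:
  assumes "\<And>x. m e x = x"
  obtains p where "\<And>t. (N (x - t *\<^sub>R e))\<^sup>2 = (N x)\<^sup>2 - 2 * t * p + t\<^sup>2"
proof -
  obtain \<alpha> \<beta> v w where vw: "v \<noteq> 0 \<or> w \<noteq> 0"
    "m x v = \<alpha> *\<^sub>R v - \<beta> *\<^sub>R w" "m x w = \<beta> *\<^sub>R v + \<alpha> *\<^sub>R w"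
    by (rule complex_eigenvector_exists [OF _ linear_right, of x]) (use dim4 in auto)
  have *: "(N (x - t *\<^sub>R e))\<^sup>2 = (\<alpha> - t)\<^sup>2 + \<beta>\<^sup>2" for t
  proof (rule similarity_eigenvalue [OF norm linear_right vw(1)])
    have "m (x - t *\<^sub>R e) y = m x y - t *\<^sub>R y" for y
      using assms by (simp add: linear_diff [OF linear_left] linear_scale [OF linear_left])
    then show "m (x - t *\<^sub>R e) v = (\<alpha> - t) *\<^sub>R v - \<beta> *\<^sub>R w"
      "m (x - t *\<^sub>R e) w = \<beta> *\<^sub>R v + (\<alpha> - t) *\<^sub>R w"
      by (simp_all add: vw algebra_simps)
  qed (rule mult)
  show thesis
    using * * [of 0]
    by (intro that [of \<alpha>]) (simp add: power2_diff)
qed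

lemma plane_euclidean:
  obtains p where "\<And>t. (N (x + t *\<^sub>R y))\<^sup>2 = (N x)\<^sup>2 + 2 * t * p + t\<^sup>2 * (N y)\<^sup>2"
proof (cases "y = 0")
  case True
  then show ?thesis using that [of 0] norm by simp
next
  case False
  define e where "e = inverse (N y) *\<^sub>R y"
  have e: "N e = 1" "y = N y *\<^sub>R e"
    using is_norm_normalize [OF norm False] False norm by (simp_all add: e_def is_normD)
  obtain a where a: "N a = 1" by (rule unit_exists)
  then have "a \<noteq> 0" using norm by auto
  \<comment> \<open>\<open>b\<close> is chosen so that the unit \<open>m a b\<close> of the isotope
    is \<open>e\<close>; the isotope keeps \<open>N\<close>.\<close>
  obtain b where b: "e = m a b" using bij_mult(1) [OF \<open>a \<noteq> 0\<close>] by (metis bij_pointE)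
  then have "N b = 1" using mult [of a b] e(1) a by simp
  interpret iso: absolute_valued_dim4 "isot a b" N
    by (rule isot_unital [OF a \<open>N b = 1\<close>])
  obtain p where p: "\<And>t. (N (x - t *\<^sub>R e))\<^sup>2 = (N x)\<^sup>2 - 2 * t * p + t\<^sup>2"
    using iso.unital_plane_euclidean [of e x] isot_unital(2) [OF a \<open>N b = 1\<close>] b by auto
  have "(N (x + t *\<^sub>R y))\<^sup>2 = (N x)\<^sup>2 + 2 * t * (N y * p) + t\<^sup>2 * (N y)\<^sup>2" for t
  proof -
    have "x + t *\<^sub>R y = x - (- (t * N y)) *\<^sub>R e"
      using e(2) by (metis diff_minus_eq_add scaleR_minus_left scaleR_scaleR)
    then show ?thesis
      by (simp only: p) (simp add: algebra_simps power_mult_distrib)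
  qed
  then show ?thesis by (rule that)
qed

section \<open>The inner product of the norm\<close>

definition ip :: "'a \<Rightarrow> 'a \<Rightarrow> real" where
  "ip x y = ((N (x + y))\<^sup>2 - (N (x - y))\<^sup>2) / 4"

lemma ip_eq: "(N (x + t *\<^sub>R y))\<^sup>2 = (N x)\<^sup>2 + 2 * t * ip x y + t\<^sup>2 * (N y)\<^sup>2"
proof -
  obtain p where p: "\<And>t. (N (x + t *\<^sub>R y))\<^sup>2 = (N x)\<^sup>2 + 2 * t * p + t\<^sup>2 * (N y)\<^sup>2"
    using plane_euclidean [of x y] by blast
  have "ip x y = p"
    using p [of 1] p [of "-1"] by (simp add: ip_def)
  then show ?thesis using p by simp
qed

lemma N_uminus: "N (- x) = N x"
  using is_normD(4) [OF norm, of "-1" x] by simp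

lemma N_diff_commute: "N (x - y) = N (y - x)"
  by (metis N_uminus minus_diff_eq)

lemma ip_commute: "ip x y = ip y x"
  by (simp add: ip_def add.commute N_diff_commute)

lemma parallelogram: "(N (x + y))\<^sup>2 + (N (x - y))\<^sup>2 = 2 * (N x)\<^sup>2 + 2 * (N y)\<^sup>2"
  using ip_eq [of x 1 y] ip_eq [of x "-1" y] by simp

text \<open>Homogeneity, for which the Jordan-von Neumann theorem usually takes a continuity
  argument, is read off from the quadratic polynomial \<open>ip_eq\<close> at \<open>c\<close> and
  \<open>- c\<close>.\<close>

lemma ip_scale: "ip x (c *\<^sub>R y) = c * ip x y"
  using ip_eq [of x c y] ip_eq [of x "-c" y] by (simp add: ip_def)

lemma ip_add: "ip (x + z) y = ip x y + ip z y"
proof -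
  have *: "ip (u + v) y + ip (u - v) y = 2 * ip u y" for u v
    using parallelogram [of "u + y" v] parallelogram [of "u - y" v]
    by (simp add: ip_def algebra_simps diff_divide_distrib)
  \<comment> \<open>Take u = (x + z)/2 and v = (x - z)/2, so that u + v = x and u - v = z.\<close>
  have "ip x y + ip z y = 2 * ip ((1/2) *\<^sub>R (x + z)) y"
    using * [of "(1/2) *\<^sub>R (x + z)" "(1/2) *\<^sub>R (x - z)"]
    by (simp add: algebra_simps flip: scaleR_add_left)
  also have "\<dots> = ip (x + z) y"
    by (simp add: ip_commute [of _ y] ip_scale)
  finally show ?thesis by simp
qed

lemma ip_bilinear:
  "ip (x + z) y = ip x y + ip z y" "ip x (y + z) = ip x y + ip x z"
  "ip (c *\<^sub>R x) y = c * ip x y" "ip x (c *\<^sub>R y) = c * ip x y"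
  "ip (x - z) y = ip x y - ip z y" "ip x (y - z) = ip x y - ip x z"
  "ip (- x) y = - ip x y" "ip x (- y) = - ip x y" "ip 0 y = 0" "ip x 0 = 0"
proof -
  have s: "ip (c *\<^sub>R x) y = c * ip x y" for c x y
    by (metis ip_commute ip_scale)
  have a: "ip x (y + z) = ip x y + ip x z" for x y z
    by (metis ip_commute ip_add)
  have n: "ip (- x) y = - ip x y" "ip x (- y) = - ip x y" for x y
    using s [of "-1"] ip_scale [of _ "-1"] by simp_all
  show "ip (x + z) y = ip x y + ip z y" "ip x (y + z) = ip x y + ip x z"
    "ip (c *\<^sub>R x) y = c * ip x y" "ip x (c *\<^sub>R y) = c * ip x y"
    "ip (- x) y = - ip x y" "ip x (- y) = - ip x y" "ip 0 y = 0" "ip x 0 = 0"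
    using s [of 0] ip_scale [of _ 0] by (simp_all add: s a n ip_add ip_scale)
  show "ip (x - z) y = ip x y - ip z y" "ip x (y - z) = ip x y - ip x z"
    using ip_add [of x "- z"] a [of x y "- z"] by (simp_all add: n)
qed

lemma ip_self: "ip x x = (N x)\<^sup>2"
  using ip_eq [of x 1 x] is_normD(4) [OF norm, of 2 x]
  by (simp add: power_mult_distrib flip: scaleR_2)

lemma ip_mult_right: "ip (m x y) (m x z) = (N x)\<^sup>2 * ip y z"
  by (simp add: ip_def mult power_mult_distrib right_diff_distrib
      flip: linear_add [OF linear_right] linear_diff [OF linear_right])

lemma ip_mult_left: "ip (m x z) (m y z) = ip x y * (N z)\<^sup>2"
  by (simp add: ip_def mult power_mult_distrib left_diff_distrib
      flip: linear_add [OF linear_left] linear_diff [OF linear_left])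

text \<open>Polarization of \<open>ip_mult_right\<close> in the left factor: the exchange law of
  composition algebras.\<close>

lemma ip_exchange: "ip (m x y) (m w z) + ip (m w y) (m x z) = 2 * ip x w * ip y z"
  using ip_mult_right [of "x + w" y z] ip_eq [of x 1 w]
  by (simp add: linear_add [OF linear_left] ip_bilinear ip_mult_right algebra_simps)

lemma ip_eqI:
  assumes "\<And>z. ip x z = ip y z"
  shows "x = y"
proof -
  have "ip (x - y) (x - y) = 0" using assms by (simp add: ip_bilinear)
  then show ?thesis using is_normD(2) [OF norm, of "x - y"] by (simp add: ip_self)
qed

end

section \<open>The unital case: Hurwitz's multiplication table\<close>

locale unital_absolute_valued_dim4 = absolute_valued_dim4 +
  fixes e
  assumes left_unit: "m e x = x" and right_unit: "m x e = x"
begin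

lemma N_unit: "N e = 1"
proof -
  obtain a where "N a = 1" by (rule unit_exists)
  then show ?thesis using mult [of e a] by (simp add: left_unit)
qed

text \<open>The exchange law with \<open>e\<close> in one slot makes both multiplications by
  \<open>u\<close> skew-adjoint.\<close>

lemma ip_adjoint:
  assumes "ip u e = 0"
  shows "ip (m u y) z = - ip y (m u z)" "ip (m y u) z = - ip y (m z u)"
proof -
  show "ip (m u y) z = - ip y (m u z)"
    using ip_exchange [of u y e z] assms by (simp add: left_unit)
  have "ip (m y u) z + ip (m z u) y = 0"
    using ip_exchange [of y u z e] assms by (simp add: right_unit)
  then show "ip (m y u) z = - ip y (m z u)"
    using ip_commute [of "m z u" y] by linarith
qed

text \<open>A skew-adjoint map that scales the inner product by N(u)^2 has square - N(u)^2. These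
  two laws supply all the associativity that the multiplication table uses.\<close>

lemma imaginary_alternative:
  assumes "ip u e = 0"
  shows "m u (m u y) = - (N u)\<^sup>2 *\<^sub>R y" "m (m y u) u = - (N u)\<^sup>2 *\<^sub>R y"
  using assms
  by (auto intro!: ip_eqI simp: ip_adjoint ip_bilinear ip_mult_right ip_mult_left)

lemma imaginary_square:
  assumes "ip u e = 0"
  shows "m u u = - (N u)\<^sup>2 *\<^sub>R e"
  using imaginary_alternative(1) [OF assms, of e] by (simp add: right_unit)

text \<open>Expand (u + v)^2: by Pythagoras the squares of \<open>u\<close> and \<open>v\<close>
  already account for it, so the mixed terms cancel.\<close>

lemma imaginary_anticommute:
  assumes "ip u e = 0" "ip v e = 0" "ip u v = 0"
  shows "m v u = - m u v"
proof -
  have "(N (u + v))\<^sup>2 = (N u)\<^sup>2 + (N v)\<^sup>2"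
    using ip_eq [of u 1 v] assms(3) by simp
  then show ?thesis
    using imaginary_square [of "u + v"] imaginary_square [of u] imaginary_square [of v] assms
    by (simp add: ip_bilinear linear_add [OF linear_left] linear_add [OF linear_right]
        algebra_simps eq_neg_iff_add_eq_0)
qed

lemma orthonormal_extension:
  assumes "finite S" "card S < 4"
    and orth: "\<And>u v. u \<in> S \<Longrightarrow> v \<in> S \<Longrightarrow> ip u v = (if u = v then 1 else 0)"
  obtains x where "N x = 1" "\<And>u. u \<in> S \<Longrightarrow> ip x u = 0"
proof -
  have "span S \<noteq> UNIV"
  proof
    assume "span S = UNIV"
    then have "dim (UNIV :: 'a set) \<le> card S"
      using assms(1) by (metis real_vector.dim_le_card subset_UNIV order_refl)
    with assms(2) dim4 show False by simp
  qed
  then obtain y where y: "y \<notin> span S" by blast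
  define x where "x = y - (\<Sum>u\<in>S. ip y u *\<^sub>R u)"
  have "x \<noteq> 0"
  proof
    assume "x = 0"
    then have "y = (\<Sum>u\<in>S. ip y u *\<^sub>R u)" by (simp add: x_def)
    moreover have "(\<Sum>u\<in>S. ip y u *\<^sub>R u) \<in> span S"
      by (intro real_vector.span_sum real_vector.span_scale real_vector.span_base)
    ultimately show False using y by simp
  qed
  have ip_sum: "ip (\<Sum>u\<in>S. f u *\<^sub>R u) v = (\<Sum>u\<in>S. f u * ip u v)" for f v
    by (induction rule: finite_induct [OF assms(1)]) (simp_all add: ip_bilinear)
  have "ip x u = 0" if "u \<in> S" for u
  proof -
    have "(\<Sum>v\<in>S. ip y v * ip v u) = (\<Sum>v\<in>S. if v = u then ip y u else 0)"
      using orth that by (intro sum.cong) auto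
    then show ?thesis using that assms(1) by (simp add: x_def ip_bilinear ip_sum)
  qed
  then show thesis
    by (intro that [of "inverse (N x) *\<^sub>R x"] is_norm_normalize [OF norm \<open>x \<noteq> 0\<close>])
      (simp add: ip_bilinear)
qed

text \<open>Choose i, j orthonormal and orthogonal to the unit, and put k = i j. Skew-adjointness
  and the scaling laws make e, i, j, k orthonormal; the alternative laws and anticommutation then
  force the whole table. Associativity is a result, not an assumption.\<close>

lemma quat_iso_exists:
  obtains f where "linear f" "bij f" "\<And>x y. f (x * y) = m (f x) (f y)" "\<And>x. N (f x) = norm (x :: quat)"
proof -
  have ee: "ip e e = 1" by (simp add: ip_self N_unit)
  obtain i where i: "N i = 1" "ip i e = 0"
    using orthonormal_extension [of "{e}"] ee by auto
  have ii: "ip i i = 1" by (simp add: ip_self i)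
  have "e \<noteq> i" using ee i by auto
  then have o: "ip u v = (if u = v then 1 else 0)" if "u \<in> {e, i}" "v \<in> {e, i}" for u v
    using that ee ii i ip_commute [of e i] by auto
  obtain j where j: "N j = 1" "ip j e = 0" "ip j i = 0"
    by (rule orthonormal_extension [of "{e, i}", OF _ _ o]) (auto simp: card_insert_if)
  have jj: "ip j j = 1" by (simp add: ip_self j)
  define k where "k = m i j"
  have k: "N k = 1" by (simp add: k_def mult i j)
  have kk: "ip k k = 1" by (simp add: ip_self k)
  have ke: "ip k e = 0" "ip k i = 0" "ip k j = 0"
    using ip_adjoint(1) [OF i(2), of j e] ip_mult_right [of i j e] ip_mult_left [of i j e] i j
    by (simp_all add: k_def right_unit left_unit ip_commute [of j i] ip_commute [of i e])
  note orth = ee ii jj kk i(2) j(2,3) ke i(2)[unfolded ip_commute [of i]]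
    j(2,3)[unfolded ip_commute [of j]] ke[unfolded ip_commute [of k]]
  have tab: "m i i = - e" "m j j = - e" "m k k = - e" "m i j = k" "m j i = - k"
    "m i k = - j" "m k j = - i" "m k i = j" "m j k = i"
  proof -
    show "m i i = - e" "m j j = - e" "m k k = - e"
      using imaginary_square i j k ke by auto
    show "m i j = k" "m j i = - k"
      using imaginary_anticommute [of i j] i j by (simp_all add: k_def ip_commute)
    show ik: "m i k = - j" and kj: "m k j = - i"
      using imaginary_alternative(1) [OF i(2), of j] imaginary_alternative(2) [OF j(2), of i] i j
      by (simp_all add: k_def)
    show "m k i = j" "m j k = i"
      using imaginary_anticommute [of i k] imaginary_anticommute [of k j] ik kj i j ke
      by (simp_all add: ip_commute)
  qed
  define f where "f x = qre x *\<^sub>R e + qim1 x *\<^sub>R i + qim2 x *\<^sub>R j + qim3 x *\<^sub>R k" for x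
  have lin: "linear f"
    by (rule linearI) (simp_all add: f_def quat_op_defs algebra_simps)
  have Nf: "N (f x) = norm x" for x
  proof -
    have "(N (f x))\<^sup>2 = (norm x)\<^sup>2"
      unfolding ip_self [symmetric]
      by (simp add: f_def ip_bilinear orth norm_quat_def power2_eq_square)
    then show ?thesis using is_normD(1) [OF norm] by simp
  qed
  have inj: "inj f"
    using lin Nf linear_injective_0 [OF lin] norm
    by (metis is_norm_0 norm_eq_zero)
  have "surj f"
  proof -
    have e: "f 1 = e" "f qi = i" "f qj = j" "f qk = k"
      by (simp_all add: f_def one_quat_def qi_def qj_def qk_def)
    have "independent {1, qi, qj, qk :: quat}"
    proof (rule real_vector.independent_if_scalars_zero)
      fix g x
      assume "(\<Sum>x\<in>{1, qi, qj, qk}. g x *\<^sub>R x) = 0" "x \<in> {1, qi, qj, qk}"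
      then show "g x = 0"
        by (auto simp: quat_op_defs qi_def qj_def qk_def)
    qed simp
    then have "independent (f ` {1, qi, qj, qk})"
      using inj by (intro linear_independent_injective_image [OF lin]) (auto intro: inj_on_subset)
    moreover have "card (f ` {1, qi, qj, qk}) = 4"
      by (simp add: inj_eq [OF inj] card_insert_if quat_op_defs qi_def qj_def qk_def)
    ultimately have "span (f ` {1, qi, qj, qk}) = UNIV"
      using dim4 by (intro independent_card_dim_spans) auto
    then have "f ` span {1, qi, qj, qk} = UNIV" using linear_span_image [OF lin] by metis
    then show ?thesis by blast
  qed
  with inj have "bij f" by (simp add: bij_def)
  moreover have "f (x * y) = m (f x) (f y)" for x y
    by (simp add: f_def linear_add [OF linear_left] linear_add [OF linear_right]
        linear_scale [OF linear_left] linear_scale [OF linear_right] left_unit right_unit tab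
        times_quat_def algebra_simps)
  ultimately show thesis using that lin Nf by blast
qed

end

text \<open>m u v is the isotope product of m u a and m a v, so in quaternion coordinates
  \<open>f\<close> and \<open>g\<close> are right and left multiplication by \<open>a\<close>; they
  are isometries because N a = 1.\<close>

lemma (in absolute_valued_dim4) isotope_of_quat:
  obtains \<phi> :: "quat \<Rightarrow> 'a" and f g where "linear \<phi>" "bij \<phi>"
    "linear f" "\<And>x. norm (f x) = norm x" "linear g" "\<And>x. norm (g x) = norm x"
    "\<And>x y. \<phi> (f x * g y) = m (\<phi> x) (\<phi> y)"
proof -
  obtain a where a: "N a = 1" by (rule unit_exists)
  then have nz: "a \<noteq> 0" using norm by auto
  interpret iso: absolute_valued_dim4 "isot a a" N
    by (rule isot_unital [OF a a])
  interpret iso: unital_absolute_valued_dim4 "isot a a" N "m a a"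
    by standard (rule isot_unital [OF a a])+
  obtain \<phi> where \<phi>: "linear \<phi>" "bij \<phi>" "\<And>x y. \<phi> (x * y) = isot a a (\<phi> x) (\<phi> y)"
    "\<And>x. N (\<phi> x) = norm (x :: quat)"
    using iso.quat_iso_exists by blast
  define \<psi> where "\<psi> = inv \<phi>"
  have \<psi>: "\<phi> (\<psi> x) = x" for x
    using \<phi>(2) by (simp add: \<psi>_def bij_is_surj surj_f_inv_f)
  have lin: "linear \<psi>"
    unfolding \<psi>_def by (rule linear_inv [OF \<phi>(1,2)])
  have N\<psi>: "norm (\<psi> x) = N x" for x
    using \<phi>(4) [of "\<psi> x"] by (simp add: \<psi>)
  show thesis
  proof (rule that [OF \<phi>(1,2)])
    show "linear (\<lambda>x. \<psi> (m (\<phi> x) a))"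
      using linear_compose [OF linear_compose [OF \<phi>(1) linear_left] lin] by (simp add: o_def)
    show "linear (\<lambda>x. \<psi> (m a (\<phi> x)))"
      using linear_compose [OF linear_compose [OF \<phi>(1) linear_right] lin] by (simp add: o_def)
  qed (simp_all add: N\<psi> mult a \<phi> \<psi> isot_mult nz)
qed

section \<open>Isometries of the quaternions and normal forms\<close>

lemma qcnj_simps [simp]:
  "qcnj (qcnj x) = x" "qcnj (x * y) = qcnj y * qcnj x" "qcnj 1 = 1" "qcnj 0 = 0"
  "qcnj (x + y) = qcnj x + qcnj y" "qcnj (x - y) = qcnj x - qcnj y" "qcnj (- x) = - qcnj x"
  "qcnj (c *\<^sub>R x) = c *\<^sub>R qcnj x"
  by (simp_all add: quat_eq_iff qcnj_def quat_op_defs algebra_simps)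

lemma qcnj_mult_self: "qcnj x * x = of_real ((norm x)\<^sup>2)" "x * qcnj x = of_real ((norm x)\<^sup>2)"
  by (simp_all add: of_real_def norm_quat_def quat_eq_iff qcnj_def quat_op_defs
      power2_eq_square algebra_simps)

lemma unit_cancel:
  assumes "norm a = 1"
  shows "qcnj a * a = 1" "a * qcnj a = 1" "qcnj a * (a * x) = x" "a * (qcnj a * x) = x"
    "x * a * qcnj a = x" "x * qcnj a * a = x"
  using assms
  by (simp_all add: qcnj_mult_self mult.assoc flip: mult.assoc [of a] mult.assoc [of "qcnj a"])

lemma norm_eq_0_quat_mult: "x * y = 0 \<longleftrightarrow> x = 0 \<or> y = (0 :: quat)"
  by (metis norm_quat_mult mult_eq_0_iff norm_eq_zero)

lemma unit_mult_left_cancel: "norm a = 1 \<Longrightarrow> a * x = a * y \<longleftrightarrow> x = (y :: quat)"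
  by (metis unit_cancel(3))

lemma unit_mult_right_cancel: "norm a = 1 \<Longrightarrow> x * a = y * a \<longleftrightarrow> x = (y :: quat)"
  by (metis unit_cancel(5))

section \<open>Orthonormal frames and isometries\<close>

definition qdot :: "quat \<Rightarrow> quat \<Rightarrow> real" where
  "qdot x y = qre x * qre y + qim1 x * qim1 y + qim2 x * qim2 y + qim3 x * qim3 y"

lemma norm_quat_square: "(norm x)\<^sup>2 = (qre x)\<^sup>2 + (qim1 x)\<^sup>2 + (qim2 x)\<^sup>2 + (qim3 x)\<^sup>2"
  by (simp add: norm_quat_def)

lemma qdot_norm: "qdot x y = ((norm (x + y))\<^sup>2 - (norm x)\<^sup>2 - (norm y)\<^sup>2) / 2"
  unfolding norm_quat_square by (simp add: qdot_def plus_quat_def power2_eq_square algebra_simps)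

lemma norm_qbasis [simp]: "norm qj = 1" "norm qk = 1"
  by (simp_all add: norm_quat_def qj_def qk_def)

lemma qdot_basis:
  "qdot 1 qi = 0" "qdot 1 qj = 0" "qdot 1 qk = 0" "qdot qi qj = 0" "qdot qi qk = 0" "qdot qj qk = 0"
  by (simp_all add: qdot_def qi_def qj_def qk_def one_quat_def)

lemma imaginary_orthogonal_anticommute:
  assumes "qre u = 0" "qre v = 0" "qdot u v = 0"
  shows "v * u = - (u * v)"
  using assms by (simp add: qdot_def quat_eq_iff quat_op_defs algebra_simps)

lemma qcnj_imaginary: "qre u = 0 \<Longrightarrow> qcnj u = - u"
  by (simp add: qcnj_def uminus_quat_def)

lemma imaginary_unit_square: "qre u = 0 \<Longrightarrow> norm u = 1 \<Longrightarrow> u * u = - 1"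
  using qcnj_mult_self(1) [of u] by (simp add: qcnj_imaginary) (metis minus_minus)

lemma qcnj_fixed_unit:
  assumes "qcnj z = z" "norm z = 1"
  shows "z = 1 \<or> z = - 1"
  using assms by (auto simp: qcnj_def quat_eq_iff norm_quat_def one_quat_def uminus_quat_def abs_if split: if_splits)

text \<open>The product u v w equals its conjugate: conjugation gives three signs and reverses the
  order, and three anticommutations restore it. A real unit is 1 or -1; this sign is the orientation
  of the frame.\<close>

lemma orthonormal_imaginary_triple:
  assumes im: "qre u = 0" "qre v = 0" "qre w = 0"
    and unit: "norm u = 1" "norm v = 1" "norm w = 1"
    and orth: "qdot u v = 0" "qdot u w = 0" "qdot v w = 0"
  shows "u * v = w \<or> u * v = - w"
proof -
  have ac: "v * u = - (u * v)" "w * u = - (u * w)" "w * v = - (v * w)"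
    using imaginary_orthogonal_anticommute im orth by auto
  have "qcnj (u * v * w) = - (w * v * u)"
    using im by (simp add: qcnj_imaginary mult.assoc)
  also have "\<dots> = v * (w * u)" by (simp add: ac(3) mult.assoc)
  also have "\<dots> = - (v * u * w)" by (simp add: ac(2) mult.assoc)
  also have "\<dots> = u * v * w" by (simp add: ac(1))
  finally have "u * v * w = 1 \<or> u * v * w = - 1"
    using unit by (intro qcnj_fixed_unit) (simp_all add: norm_quat_mult)
  moreover have "u * v = - (u * v * w * w)"
    using imaginary_unit_square [of w] im unit by (simp add: mult.assoc)
  ultimately show ?thesis by auto
qed

text \<open>
  The conjugating element is \<open>y - u y \<i> - v y \<j> - w y \<k>\<close> for some basis element \<open>y\<close>;
  these do not all vanish since \<open>y \<mapsto> p y q\<close> has trace \<open>4 Re p Re q\<close>.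
\<close>

lemma imaginary_frame_conjugate:
  assumes im: "qre u = 0" "qre v = 0" "qre w = 0"
    and unit: "norm u = 1" "norm v = 1" "norm w = 1"
    and orth: "qdot u v = 0" and uv: "u * v = w"
  obtains q where "norm q = 1" "u * q = q * qi" "v * q = q * qj" "w * q = q * qk"
proof -
  have sq: "u * u = - 1" "v * v = - 1" "w * w = -1"
    using imaginary_unit_square im unit by auto
  have vu: "v * u = - w" using imaginary_orthogonal_anticommute im orth uv by auto
  have tab: "u * w = - v" "w * v = - u" "v * w = u" "w * u = v"
  proof -
    show uw: "u * w = - v" and wv: "w * v = - u"
      by (simp_all add: sq mult.assoc flip: uv, simp add: sq flip: mult.assoc)
    have "v * u * v = - (w * v)" by (simp add: vu)
    then show "v * w = u" by (simp add: wv uv mult.assoc)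
    have "w * u = u * (v * u)" by (simp add: mult.assoc flip: uv)
    then show "w * u = v" by (simp add: vu uw)
  qed
  have tab': "u * (u * x) = - x" "v * (v * x) = - x" "w * (w * x) = - x" "u * (v * x) = w * x"
    "v * (u * x) = - (w * x)" "u * (w * x) = - (v * x)" "w * (v * x) = - (u * x)"
    "v * (w * x) = u * x" "w * (u * x) = v * x" for x
    by (simp_all add: sq uv vu tab flip: mult.assoc)
  \<comment> \<open>\<open>Q y\<close> is the sum of y, u y i^-1, v y j^-1 and w y k^-1: averaging
    over the quaternion group yields an intertwiner.\<close>
  define Q where "Q y = y - u * y * qi - v * y * qj - w * y * qk" for y
  have Q: "u * Q y = Q y * qi" "v * Q y = Q y * qj" "w * Q y = Q y * qk" for y
    by (simp_all add: Q_def algebra_simps mult.assoc quat_basis_mult tab')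
  have "qre (Q 1) + qim1 (Q qi) + qim2 (Q qj) + qim3 (Q qk) = 4"
    using im by (simp add: Q_def quat_op_defs qi_def qj_def qk_def)
  then have "\<exists>y. Q y \<noteq> 0"
    by (metis add.right_neutral quat.sel zero_neq_numeral zero_quat_def)
  then obtain y where y: "Q y \<noteq> 0" by blast
  show thesis
    using y Q [of y] by (intro that [of "inverse (norm (Q y)) *\<^sub>R Q y"]) simp_all
qed

lemma linear_eq_on_qbasis:
  assumes "linear f" "linear g" "f 1 = g 1" "f qi = g qi" "f qj = g qj" "f qk = g qk"
  shows "f x = g x"
  using assms(3-)
  by (subst (1 2) quat_basis_expansion)
    (simp add: linear_add [OF assms(1)] linear_add [OF assms(2)]
      linear_scale [OF assms(1)] linear_scale [OF assms(2)])

lemma linear_qmult: "linear (\<lambda>x. a * x * b :: quat)" "linear (\<lambda>x. a * qcnj x * b)"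
  by (auto intro!: linearI simp: algebra_simps)

lemma frame_isometry:
  assumes lin: "linear f" and "f 1 = 1"
    and iso: "\<And>x. norm (f x) = norm (x :: quat)" and "f qi * f qj = f qk"
  obtains q where "norm q = 1" "\<And>x. f x = q * x * qcnj q"
proof -
  have dot: "qdot (f x) (f y) = qdot x y" for x y
    by (simp add: qdot_norm iso flip: linear_add [OF lin])
  have im: "qre (f qi) = 0" "qre (f qj) = 0" "qre (f qk) = 0"
    using dot [of 1 qi] dot [of 1 qj] dot [of 1 qk] assms(2)
    by (simp_all add: qdot_basis, simp_all add: qdot_def one_quat_def)
  obtain q where q: "norm q = 1" "f qi * q = q * qi" "f qj * q = q * qj" "f qk * q = q * qk"
    using imaginary_frame_conjugate [OF im] assms(4) iso dot [of qi qj]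
    by (auto simp: qdot_basis)
  have "f x = q * x * qcnj q" for x
  proof (rule linear_eq_on_qbasis [OF lin linear_qmult(1)])
    show "f 1 = q * 1 * qcnj q" by (simp add: assms(2) unit_cancel q)
    show "f qi = q * qi * qcnj q" "f qj = q * qj * qcnj q" "f qk = q * qk * qcnj q"
      by (simp_all add: unit_cancel q flip: q(2-))
  qed
  with q(1) show thesis by (rule that)
qed

text \<open>Dividing by \<open>f 1\<close> leaves an isometry that fixes 1 and maps i, j, k to an
  orthonormal imaginary frame. The orientation of the frame decides between the two shapes;
  composing with conjugation reverses it.\<close>

lemma quat_isometry:
  assumes lin: "linear f" and iso: "\<And>x. norm (f x) = norm (x :: quat)"
  obtains a b where "norm a = 1" "norm b = 1"
    "(\<forall>x. f x = a * x * b) \<or> (\<forall>x. f x = a * qcnj x * b)"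
proof -
  define c where "c = f 1"
  have c: "norm c = 1" by (simp add: c_def iso)
  define g where "g x = qcnj c * f x" for x
  have f: "f x = c * g x" for x by (simp add: g_def unit_cancel c)
  have g: "linear g" "g 1 = 1" "norm (g x) = norm x" for x
    using c by (auto intro!: linearI simp: g_def linear_add [OF lin] linear_scale [OF lin]
        distrib_left unit_cancel iso norm_quat_mult c_def [symmetric])
  have dot: "qdot (g x) (g y) = qdot x y" for x y
    by (simp add: qdot_norm g flip: linear_add [OF g(1)])
  have im: "qre (g qi) = 0" "qre (g qj) = 0" "qre (g qk) = 0"
    using dot [of 1 qi] dot [of 1 qj] dot [of 1 qk] g(2)
    by (simp_all add: qdot_basis, simp_all add: qdot_def one_quat_def)
  have "g qi * g qj = g qk \<or> g qi * g qj = - g qk"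
    using im dot by (intro orthonormal_imaginary_triple) (simp_all add: g(3) qdot_basis)
  then show thesis
  proof
    assume "g qi * g qj = g qk"
    then obtain q where "norm q = 1" "\<And>x. g x = q * x * qcnj q"
      using frame_isometry [OF g] by blast
    then show thesis using c
      by (intro that [of "c * q" "qcnj q"]) (simp_all add: f norm_quat_mult mult.assoc)
  next
    assume *: "g qi * g qj = - g qk"
    have "qcnj qi = - qi" "qcnj qj = - qj" "qcnj qk = - qk"
      by (simp_all add: qcnj_def qi_def qj_def qk_def uminus_quat_def)
    then have "g (qcnj qi) * g (qcnj qj) = g (qcnj qk)"
      using * by (simp add: linear_neg [OF g(1)])
    moreover have "linear (\<lambda>x. g (qcnj x))"
      using linear_compose [OF linear_qcnj g(1)] by (simp add: o_def)
    ultimately obtain q where q: "norm q = 1" "\<And>x. g (qcnj x) = q * x * qcnj q"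
      using frame_isometry [of "\<lambda>x. g (qcnj x)"] g by auto
    have "g x = q * qcnj x * qcnj q" for x
      using q(2) [of "qcnj x"] by simp
    with q(1) show thesis using c
      by (intro that [of "c * q" "qcnj q"]) (simp_all add: f norm_quat_mult mult.assoc)
  qed
qed

lemma unit_conjugate_complex:
  obtains u where "norm u = 1" "qim2 (qcnj u * a * u) = 0" "qim3 (qcnj u * a * u) = 0"
proof -
  define \<alpha> where "\<alpha> = Quat 0 (qim1 a) (qim2 a) (qim3 a)"
  define r where "r = norm \<alpha>"
  have a: "a = of_real (qre a) + \<alpha>"
    by (simp add: \<alpha>_def of_real_def quat_eq_iff quat_op_defs)
  have im: "qcnj \<alpha> = - \<alpha>" by (simp add: \<alpha>_def qcnj_imaginary)
  have \<alpha>2: "\<alpha> * \<alpha> = - of_real (r\<^sup>2)"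
    using qcnj_mult_self(1) [of \<alpha>] by (simp add: im r_def) (metis minus_minus)
  \<comment> \<open>Both \<open>\<alpha> * u\<close> and \<open>u * (r *\<^sub>R qi)\<close> equal r
    alpha + r^2 i, because alpha^2 = - r^2. The choice vanishes only for alpha = - r i, when
    \<open>a\<close> is complex already.\<close>
  define u where "u = of_real r - \<alpha> * qi"
  show thesis
  proof (cases "u = 0")
    case True
    then have "\<alpha> * qi = of_real r" by (simp add: u_def)
    then have "qim2 a = 0" "qim3 a = 0"
      by (auto simp: \<alpha>_def qi_def of_real_def quat_op_defs quat_eq_iff)
    then show thesis using that [of 1] by simp
  next
    case False
    define v where "v = inverse (norm u) *\<^sub>R u"
    have v: "norm v = 1" using False by (simp add: v_def)
    have "\<alpha> * u = u * (r *\<^sub>R qi)"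
      using \<alpha>2 by (simp add: u_def algebra_simps quat_basis_mult mult.assoc [of \<alpha>] of_real_def power2_eq_square
          flip: mult.assoc [of \<alpha> \<alpha>])
    then have "\<alpha> * v = v * (r *\<^sub>R qi)" by (simp add: v_def)
    then have "qcnj v * a * v = of_real (qre a) + r *\<^sub>R qi"
      using v by (subst a) (simp add: algebra_simps of_real_def mult.assoc unit_cancel)
    then show thesis using v
      by (intro that [of v]) (simp_all add: of_real_def qi_def quat_op_defs)
  qed
qed

section \<open>Isomorphisms and the four families of isotopes\<close>

lemma alg_isomorphic_refl: "alg_isomorphic m m"
  by (auto simp: alg_isomorphic_def intro!: exI [of _ id] linearI)

lemma alg_isomorphic_trans:
  assumes "alg_isomorphic m1 m2" "alg_isomorphic m2 m3" shows "alg_isomorphic m1 m3"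
  using assms unfolding alg_isomorphic_def
  by (metis bij_comp comp_apply linear_compose)

lemma alg_isomorphic_sym:
  assumes "alg_isomorphic m n" shows "alg_isomorphic n m"
proof -
  obtain f where f: "linear f" "bij f" "\<And>x y. f (m x y) = n (f x) (f y)"
    using assms by (auto simp: alg_isomorphic_def)
  have "inv f (n x y) = m (inv f x) (inv f y)" for x y
    using f by (intro inv_f_eq) (simp_all add: bij_is_inj bij_is_surj surj_f_inv_f)
  then show ?thesis
    unfolding alg_isomorphic_def using linear_inv [OF f(1,2)] bij_imp_bij_inv [OF f(2)] by blast
qed

lemma alg_isomorphic_opposite:
  "alg_isomorphic m n \<longleftrightarrow> alg_isomorphic (\<lambda>x y. m y x) (\<lambda>x y. n y x)"
  by (auto simp: alg_isomorphic_def)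

lemma alg_isomorphic_quatI:
  fixes m n :: "quat \<Rightarrow> quat \<Rightarrow> quat"
  assumes "norm p = 1" "norm q = 1" "\<And>x y. p * m x y * q = n (p * x * q) (p * y * q)"
  shows "alg_isomorphic m n"
proof -
  have "bij (\<lambda>x. p * x * q)"
    by (rule bij_betw_byWitness [of _ "\<lambda>x. qcnj p * x * qcnj q"])
      (auto simp: assms unit_cancel mult.assoc)
  then show ?thesis
    unfolding alg_isomorphic_def using assms(3) linear_qmult(1) [of p q] by blast
qed

lemma alg_isomorphic_qcnjI:
  assumes "\<And>x y. qcnj (m x y) = n (qcnj x) (qcnj y)"
  shows "alg_isomorphic m n"
proof -
  have "bij qcnj" by (rule bij_betw_byWitness [of _ qcnj]) auto
  then show ?thesis
    unfolding alg_isomorphic_def using assms linear_qcnj by blast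
qed

definition id_isotope :: "quat \<Rightarrow> quat \<Rightarrow> quat \<Rightarrow> quat \<Rightarrow> quat" where
  "id_isotope a b x y = a * x * y * b"

definition topstar_isotope :: "quat \<Rightarrow> quat \<Rightarrow> quat \<Rightarrow> quat \<Rightarrow> quat" where
  "topstar_isotope a b x y = a * qcnj x * qcnj y * b"

lemmas isotope_defs = id_isotope_def topstar_isotope_def lstar_isotope_def rstar_isotope_def

text \<open>The product f x * g y has constants at both ends and in the middle. In each family a
  one-sided multiplication, taken as isomorphism, absorbs one of these three, which leaves two
  parameters.\<close>

lemma absolute_valued_normal_form:
  fixes m :: "'a::real_vector \<Rightarrow> 'a \<Rightarrow> 'a"
  assumes "dim (UNIV :: 'a set) = 4" "absolute_valued m"
  obtains a b where "norm a = 1" "norm b = 1"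
    "alg_isomorphic m (id_isotope a b) \<or> alg_isomorphic m (topstar_isotope a b) \<or>
     alg_isomorphic m (lstar_isotope a b) \<or> alg_isomorphic m (rstar_isotope a b)"
proof -
  obtain N where N: "is_norm N" "bilinear m" "\<And>x y. N (m x y) = N x * N y"
    using assms(2) by (auto simp: absolute_valued_def)
  then interpret absolute_valued_dim4 m N
    using assms(1) by unfold_locales
  obtain \<phi> :: "quat \<Rightarrow> 'a" and f g where \<phi>: "linear \<phi>" "bij \<phi>"
    and fg: "linear f" "\<And>x. norm (f x) = norm x" "linear g" "\<And>x. norm (g x) = norm x"
    and "\<And>x y. \<phi> (f x * g y) = m (\<phi> x) (\<phi> y)"
    by (rule isotope_of_quat) blast
  then have "alg_isomorphic (\<lambda>x y. f x * g y) m"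
    unfolding alg_isomorphic_def by blast
  then have iso: "alg_isomorphic m (\<lambda>x y. f x * g y)" by (rule alg_isomorphic_sym)
  obtain a b where ab: "norm a = 1" "norm b = 1"
    and f: "(\<forall>x. f x = a * x * b) \<or> (\<forall>x. f x = a * qcnj x * b)"
    by (rule quat_isometry [OF fg(1,2)]) blast
  obtain c d where cd: "norm c = 1" "norm d = 1"
    and g: "(\<forall>x. g x = c * x * d) \<or> (\<forall>x. g x = c * qcnj x * d)"
    by (rule quat_isometry [OF fg(3,4)]) blast
  note unit = ab cd
  note simps = isotope_defs unit norm_quat_mult mult.assoc unit_cancel
  note step = alg_isomorphic_trans [OF iso alg_isomorphic_quatI]
  show thesis
    using f g
  proof (elim disjE)
    assume "\<forall>x. f x = a * x * b" "\<forall>x. g x = c * x * d"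
    then have "alg_isomorphic m (id_isotope a (qcnj (b * c) * d * (b * c)))"
      by (intro step [of 1 "b * c"]) (simp_all add: simps)
    then show thesis by (intro that [of a "qcnj (b * c) * d * (b * c)"]) (simp_all add: simps)
  next
    assume "\<forall>x. f x = a * qcnj x * b" "\<forall>x. g x = c * x * d"
    then have "alg_isomorphic m (lstar_isotope (b * c) (a * d * qcnj a))"
      by (intro step [of 1 "qcnj a"]) (simp_all add: simps)
    then show thesis by (intro that [of "b * c" "a * d * qcnj a"]) (simp_all add: simps)
  next
    assume "\<forall>x. f x = a * x * b" "\<forall>x. g x = c * qcnj x * d"
    then have "alg_isomorphic m (rstar_isotope (qcnj d * a * d) (b * c))"
      by (intro step [of "qcnj d" 1]) (simp_all add: simps)
    then show thesis by (intro that [of "qcnj d * a * d" "b * c"]) (simp_all add: simps)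
  next
    assume "\<forall>x. f x = a * qcnj x * b" "\<forall>x. g x = c * qcnj x * d"
    then have "alg_isomorphic m (topstar_isotope (a * qcnj (b * c)) (d * qcnj (b * c)))"
      by (intro step [of 1 "qcnj (b * c)"]) (simp_all add: simps)
    then show thesis
      by (intro that [of "a * qcnj (b * c)" "d * qcnj (b * c)"]) (simp_all add: simps)
  qed
qed

section \<open>The identities in complex coordinates\<close>

text \<open>\<open>pw m p x\<close> is the power \<open>x\<^sup>p\<close> only for \<open>p \<in> {1, 2}\<close>.\<close>

definition pw :: "('a \<Rightarrow> 'a \<Rightarrow> 'a) \<Rightarrow> nat \<Rightarrow> 'a \<Rightarrow> 'a" where
  "pw m p x = (if p = 2 then sq m x else x)"

text \<open>All eight identities in one predicate, so that passing to the opposite product merely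
  reverses the exponents.\<close>

definition sat :: "('a::real_vector \<Rightarrow> 'a \<Rightarrow> 'a) \<Rightarrow> nat \<Rightarrow> nat \<Rightarrow> nat \<Rightarrow> bool" where
  "sat m p q r \<longleftrightarrow> (\<forall>x. associator m (pw m p x) (pw m q x) (pw m r x) = 0)"

lemma sat_isomorphic:
  assumes "alg_isomorphic m n" shows "sat m p q r \<longleftrightarrow> sat n p q r"
proof -
  have *: "sat m p q r" if iso: "alg_isomorphic m n" and s: "sat n p q r"
    for m :: "'c::real_vector \<Rightarrow> 'c \<Rightarrow> 'c" and n :: "'d::real_vector \<Rightarrow> 'd \<Rightarrow> 'd"
  proof -
    obtain f where f: "linear f" "bij f" "\<And>x y. f (m x y) = n (f x) (f y)"
      using iso by (auto simp: alg_isomorphic_def)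
    have pw: "f (pw m p x) = pw n p (f x)" for p x
      by (simp add: pw_def sq_def f)
    have "f (associator m (pw m p x) (pw m q x) (pw m r x)) = 0" for x
      using s by (simp add: associator_def linear_diff [OF f(1)] f(3) pw sat_def)
    then show ?thesis
      using f(1,2) by (metis sat_def bij_is_inj inj_eq linear_0)
  qed
  show ?thesis using * [OF assms] * [OF alg_isomorphic_sym [OF assms]] by blast
qed

text \<open>Reversing the product turns the associator into the negative of the associator with
  reversed arguments.\<close>

lemma sat_opposite: "sat (\<lambda>x y. m y x) p q r \<longleftrightarrow> sat m r q p"
proof -
  have "pw (\<lambda>x y. m y x) p x = pw m p x" for p x
    by (simp add: pw_def sq_def)
  then show ?thesis
    by (simp add: sat_def associator_def) (metis eq_commute)
qed

lemma id_isotope_associator: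
  assumes "norm a = 1" "norm b = 1"
  shows "associator (id_isotope a b) u v w = 0 \<longleftrightarrow> a * u * v * b * w = u * a * v * w * b"
proof -
  have "associator (id_isotope a b) u v w = 0 \<longleftrightarrow>
      a * (a * u * v * b * w) * b = a * (u * a * v * w * b) * b"
    by (simp add: associator_def id_isotope_def mult.assoc)
  then show ?thesis
    using assms by (simp only: unit_mult_left_cancel unit_mult_right_cancel)
qed

lemma topstar_isotope_associator:
  assumes "norm a = 1" "norm b = 1"
  shows "associator (topstar_isotope a b) u v w = 0 \<longleftrightarrow>
    qcnj b * v * u * qcnj a * qcnj w = qcnj u * qcnj b * w * v * qcnj a"
proof -
  have "associator (topstar_isotope a b) u v w = 0 \<longleftrightarrow>
      a * (qcnj b * v * u * qcnj a * qcnj w) * b = a * (qcnj u * qcnj b * w * v * qcnj a) * b"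
    by (simp add: associator_def topstar_isotope_def mult.assoc)
  then show ?thesis
    using assms by (simp only: unit_mult_left_cancel unit_mult_right_cancel)
qed

lemma lstar_isotope_associator:
  assumes "norm a = 1" "norm b = 1"
  shows "associator (lstar_isotope a b) u v w = 0 \<longleftrightarrow>
    qcnj b * qcnj v * qcnj a * u * a * w = qcnj u * a * qcnj v * a * w * b"
proof -
  have "associator (lstar_isotope a b) u v w = 0 \<longleftrightarrow>
      (qcnj b * qcnj v * qcnj a * u * a * w) * b = (qcnj u * a * qcnj v * a * w * b) * b"
    by (simp add: associator_def lstar_isotope_def mult.assoc)
  then show ?thesis
    using assms by (simp only: unit_mult_right_cancel)
qed

text \<open>\<open>cq p q\<close> is \<open>p + q \<j>\<close>.\<close>

definition cq :: "complex \<Rightarrow> complex \<Rightarrow> quat" where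
  "cq p q = Quat (Re p) (Im p) (Re q) (Im q)"

lemma cq_cases: obtains p q where "x = cq p q"
  by (rule that [of "Complex (qre x) (qim1 x)" "Complex (qim2 x) (qim3 x)"]) (simp add: cq_def)

lemma cq_simps:
  "cq p q * cq r s = cq (p * r - q * cnj s) (p * s + q * cnj r)"
  "qcnj (cq p q) = cq (cnj p) (- q)" "cq p q + cq r s = cq (p + r) (q + s)"
  "cq p q - cq r s = cq (p - r) (q - s)" "- cq p q = cq (- p) (- q)"
  by (simp_all add: cq_def quat_op_defs qcnj_def algebra_simps)

lemma cq_eq_iff: "cq p q = cq r s \<longleftrightarrow> p = r \<and> q = s"
  by (auto simp: cq_def complex_eq_iff)

lemma cq_unit: "norm (cq p q) = 1 \<longleftrightarrow> p * cnj p + q * cnj q = 1"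
  by (simp add: norm_quat_def cq_def complex_mult_cnj complex_eq_iff add.assoc)

lemma cq_1: "cq 1 0 = 1" and cq_minus_1: "cq (- 1) 0 = - 1"
  by (simp_all add: cq_def one_quat_def uminus_quat_def)

lemma cancel_both:
  assumes "l * x * r = l * y * (r :: quat)" "norm l = 1" "norm r = 1"
  shows "x = y"
  using assms by (simp only: unit_mult_left_cancel unit_mult_right_cancel)

text \<open>Rewrite rules that move \<open>a\<close> and its conjugate to the left of
  \<open>x\<close> and its conjugate, so that words in commuting letters get a normal form between
  occurrences of the second parameter.\<close>

lemma commuting_units:
  assumes a: "norm a = 1" and x: "norm x = 1" and "x * a = a * (x :: quat)"
  shows "x * a = a * x" "x * (a * y) = a * (x * y)"
    "x * qcnj a = qcnj a * x" "x * (qcnj a * y) = qcnj a * (x * y)"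
    "qcnj x * a = a * qcnj x" "qcnj x * (a * y) = a * (qcnj x * y)"
    "qcnj x * qcnj a = qcnj a * qcnj x" "qcnj x * (qcnj a * y) = qcnj a * (qcnj x * y)"
proof -
  have *: "qcnj u * v = v * qcnj u" if "norm u = 1" "v * u = u * v" for u v
  proof -
    have "qcnj u * v = qcnj u * (v * u) * qcnj u" using that(1) by (simp add: unit_cancel mult.assoc)
    also have "\<dots> = v * qcnj u" unfolding that(2) using that(1) by (simp add: unit_cancel flip: mult.assoc)
    finally show ?thesis .
  qed
  show 1: "x * a = a * x" by fact
  show 2: "x * qcnj a = qcnj a * x" using * [OF a 1] by simp
  show 3: "qcnj x * a = a * qcnj x" using * [OF x] 1 by simp
  show 4: "qcnj x * qcnj a = qcnj a * qcnj x" using * [OF x] 2 by simp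
  show "x * (a * y) = a * (x * y)" "x * (qcnj a * y) = qcnj a * (x * y)"
    "qcnj x * (a * y) = a * (qcnj x * y)" "qcnj x * (qcnj a * y) = qcnj a * (qcnj x * y)"
    using 1 2 3 4 by (simp_all flip: mult.assoc)
qed

lemma cnj_fixed_unit: "z * cnj z = 1 \<Longrightarrow> cnj z = z \<Longrightarrow> z = 1 \<or> z = - 1"
  by (metis power2_eq_square power2_eq_1_iff)

lemma square_eq_minus_one: "z * z = - 1 \<Longrightarrow> z = \<i> \<or> z = - \<i>"
  by (metis power2_eq_square power2_i power2_eq_iff)

text \<open>The last two hypotheses make z conj(s) and s z real. Hence z^2 = (z conj(s)) (z s) is
  real, so it is 1 or -1, and s^2 is the same product.\<close>

lemma unit_pair_real_products:
  assumes u: "z * cnj z = 1" "s * cnj s = 1" and "z * cnj s = s * cnj z" "s * z = cnj s * cnj z"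
  shows "(z = 1 \<or> z = - 1 \<or> z = \<i> \<or> z = - \<i>) \<and> (s = z \<or> s = - z)"
proof -
  have "z * z = (z * cnj s) * (z * s)" using u by algebra
  also have "\<dots> = s * s" using assms by algebra
  finally have zs: "z * z = s * s" .
  have "(z * z) * (z * z) = (s * z) * (s * z)" using zs by algebra
  also have "\<dots> = 1" using assms by algebra
  finally have "z * z = 1 \<or> z * z = - 1" by (metis power2_eq_square power2_eq_1_iff)
  moreover have "s = z \<or> s = - z" using zs by (metis power2_eq_square power2_eq_iff)
  ultimately show ?thesis using square_eq_minus_one by (metis power2_eq_square power2_eq_1_iff)
qed

text \<open>(3 + 4i)/5 lies on the circle and is not a root of unity; its rational coordinates make
  the inequalities a computation.\<close>

lemma generic_unit:
  obtains \<rho> :: complex where "\<rho> * cnj \<rho> = 1" "cnj \<rho> * cnj \<rho> \<noteq> \<rho> * \<rho>"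
    "\<rho> * \<rho> * \<rho> * \<rho> \<noteq> 1" "\<rho> * \<rho> * \<rho> * \<rho> * \<rho> * \<rho> \<noteq> 1"
  by (rule that [of "Complex (3/5) (4/5)"]) (simp_all add: complex_eq_iff)

section \<open>The family a x y b\<close>

lemma id_isotope_satD:
  assumes "sat (id_isotope a b) p q r" "norm a = 1" "norm b = 1"
  shows "a * pw (id_isotope a b) p x * pw (id_isotope a b) q x * b * pw (id_isotope a b) r x =
    pw (id_isotope a b) p x * a * pw (id_isotope a b) q x * pw (id_isotope a b) r x * b"
  using assms by (simp add: sat_def id_isotope_associator)

locale complex_parameter =
  fixes z s t :: complex
  assumes z: "z * cnj z = 1" and st: "s * cnj s + t * cnj t = 1"
begin

lemma unit_a: "norm (cq z 0) = 1" and unit_b: "norm (cq s t) = 1"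
  using z st by (simp_all add: cq_unit)

lemma comm_a: "cq w 0 * cq z 0 = cq z 0 * cq w 0"
  by (simp add: cq_simps mult.commute)

lemma z_nz: "z \<noteq> 0" using z by auto

lemmas idD = id_isotope_satD [OF _ unit_a unit_b]
lemmas pw_simps = pw_def sq_def isotope_defs
lemma norm_cq_complex: "w * cnj w = 1 \<Longrightarrow> norm (cq w 0) = 1"
  by (simp add: cq_unit)

lemmas circle_simps = commuting_units [OF unit_a norm_cq_complex comm_a]
lemmas norm_simps = norm_cq_complex unit_a unit_b norm_quat_mult
lemmas cancel_simps = mult.assoc unit_cancel unit_a unit_b norm_cq_complex

lemma commutes_i_imp: "cq s t * cq \<i> 0 = cq \<i> 0 * cq s t \<Longrightarrow> t = 0"
  by (simp add: cq_simps cq_eq_iff eq_neg_iff_add_eq_0)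

text \<open>At a complex unit \<open>x\<close> the letters a and x commute and mostly cancel.
  Exponents (1,1,1) and (1,2,1) leave that \<open>b\<close> commutes with i, and (1,1,2) and (1,2,2)
  that it commutes with every a x x. Either way the j-component \<open>t\<close> vanishes.\<close>

lemma id_isotope_circle:
  assumes "sat (id_isotope (cq z 0) (cq s t)) p q r"
    "(p, q, r) \<in> {(1,1,1), (1,2,1), (1,1,2), (1,2,2), (2,1,2)}"
  shows "t = 0"
proof -
  obtain \<rho> :: complex where \<rho>: "\<rho> * cnj \<rho> = 1" "cnj \<rho> * cnj \<rho> \<noteq> \<rho> * \<rho>" "\<rho> * \<rho> * \<rho> * \<rho> \<noteq> 1"
    by (rule generic_unit)
  let ?a = "cq z 0" and ?b = "cq s t"
  note D = idD [OF assms(1), of "cq w 0" for w, unfolded pw_simps]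
  have *: "t = 0" if "\<And>w. w * cnj w = 1 \<Longrightarrow> ?b * (?a * cq w 0 * cq w 0) = (?a * cq w 0 * cq w 0) * ?b"
  proof -
    have "t * cnj z = z * t" "t * (cnj z * cnj \<rho> * cnj \<rho>) = z * \<rho> * \<rho> * t"
      using that [of 1] that [OF \<rho>(1)] by (simp_all add: cq_simps cq_eq_iff)
    then have "t * z * (cnj \<rho> * cnj \<rho> - \<rho> * \<rho>) = 0" by algebra
    then show ?thesis using \<rho>(2) z_nz by simp
  qed
  from assms(2) consider "p = 1" "q = 1" "r = 1" | "p = 1" "q = 2" "r = 1" | "p = 1" "q = 1" "r = 2"
    | "p = 1" "q = 2" "r = 2" | "p = 2" "q = 1" "r = 2" by auto
  then show ?thesis
  proof cases
    case 1
    have "?b * cq \<i> 0 = cq \<i> 0 * ?b"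
    proof (rule cancel_both [where r = 1])
      let ?x = "cq \<i> 0"
      show "(?a * ?x * ?x) * (?b * ?x) * 1 = (?a * ?x * ?x) * (?x * ?b) * 1"
        using D [of \<i>] by (simp add: 1 circle_simps [of \<i>] cancel_simps)
    qed (simp_all add: norm_simps)
    then show ?thesis by (rule commutes_i_imp)
  next
    case 2
    have "?b * cq \<i> 0 = cq \<i> 0 * ?b"
    proof (rule cancel_both [where r = 1])
      let ?x = "cq \<i> 0"
      show "(?a * ?x * ?a * ?x * ?x * ?b) * (?b * ?x) * 1 = (?a * ?x * ?a * ?x * ?x * ?b) * (?x * ?b) * 1"
        using D [of \<i>] by (simp add: 2 circle_simps [of \<i>] cancel_simps)
    qed (simp_all add: norm_simps)
    then show ?thesis by (rule commutes_i_imp)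
  next
    case 3
    show ?thesis
    proof (rule *)
      fix w :: complex assume w: "w * cnj w = 1"
      let ?x = "cq w 0"
      show "?b * (?a * ?x * ?x) = (?a * ?x * ?x) * ?b"
      proof (rule cancel_both)
        show "(?a * ?x * ?x) * (?b * (?a * ?x * ?x)) * ?b = (?a * ?x * ?x) * ((?a * ?x * ?x) * ?b) * ?b"
          using D [of w] by (simp add: 3 circle_simps [OF w] cancel_simps w)
      qed (simp_all add: norm_simps w)
    qed
  next
    case 4
    show ?thesis
    proof (rule *)
      fix w :: complex assume w: "w * cnj w = 1"
      let ?x = "cq w 0"
      show "?b * (?a * ?x * ?x) = (?a * ?x * ?x) * ?b"
      proof (rule cancel_both)
        show "(?a * ?x * ?a * ?x * ?x * ?b) * (?b * (?a * ?x * ?x)) * ?b =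
            (?a * ?x * ?a * ?x * ?x * ?b) * ((?a * ?x * ?x) * ?b) * ?b"
          using D [of w] by (simp add: 4 circle_simps [OF w] cancel_simps w)
      qed (simp_all add: norm_simps w)
    qed
  next
    case 5
    have E: "?a * ?b * cq w 0 * ?b * ?a * cq w 0 * cq w 0 = ?b * ?a * ?a * cq w 0 * cq w 0 * cq w 0 * ?b"
      if w: "w * cnj w = 1" for w
    proof (rule cancel_both)
      let ?x = "cq w 0"
      show "(?a * ?x * ?x) * (?a * ?b * ?x * ?b * ?a * ?x * ?x) * ?b =
          (?a * ?x * ?x) * (?b * ?a * ?a * ?x * ?x * ?x * ?b) * ?b"
        using D [of w] by (simp add: 5 circle_simps [OF w] cancel_simps w)
    qed (simp_all add: norm_simps w)
    \<comment> \<open>The terms in s^2 cancel; the remaining ones turn with \<open>w\<close> at the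
      rates 1 and -3, so they can agree at both 1 and \<open>\<rho>\<close> only if t = 0.\<close>
    have "t * cnj t * (z * z * w) = t * cnj t * (cnj z * cnj z * cnj w * cnj w * cnj w)"
      if w: "w * cnj w = 1" for w
    proof -
      have "(z * s * w * s - z * t * cnj w * cnj t) * z * w * w =
          s * z * z * w * w * w * s - t * cnj z * cnj z * cnj w * cnj w * cnj w * cnj t"
        using E [OF w] by (simp add: cq_simps cq_eq_iff)
      then show ?thesis using w by algebra
    qed
    from this [of 1] this [OF \<rho>(1)] have "t * cnj t * (z * z) * (\<rho> * \<rho> * \<rho> * \<rho> - 1) = 0"
      using \<rho>(1) by simp algebra
    then show ?thesis using \<rho>(3) z_nz by simp
  qed
qed

end

section \<open>The family a conj(x) conj(y) b\<close>

lemma topstar_isotope_satD: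
  assumes "sat (topstar_isotope a b) p q r" "norm a = 1" "norm b = 1"
  shows "qcnj b * pw (topstar_isotope a b) q x * pw (topstar_isotope a b) p x * qcnj a *
      qcnj (pw (topstar_isotope a b) r x) =
    qcnj (pw (topstar_isotope a b) p x) * qcnj b * pw (topstar_isotope a b) r x *
      pw (topstar_isotope a b) q x * qcnj a"
  using assms by (simp add: sat_def topstar_isotope_associator)

context complex_parameter
begin

lemmas topstarD = topstar_isotope_satD [OF _ unit_a unit_b]

text \<open>With \<open>t = 0\<close> the identity is empty on complex numbers, so the test points
  j, 1 + j and 1 + i + j lie outside them.\<close>

lemma id_isotope_complex:
  assumes sat: "sat (id_isotope (cq z 0) (cq s t)) p q r"
    and pqr: "(p, q, r) \<in> {(1,1,1), (1,2,1), (1,1,2), (1,2,2), (2,1,2)}"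
  shows "(z = 1 \<or> z = - 1) \<and> t = 0 \<and> (s = 1 \<or> s = - 1)"
proof -
  have t: "t = 0" by (rule id_isotope_circle [OF assms])
  have s: "s * cnj s = 1" using st t by simp
  have nz: "s \<noteq> 0" "z \<noteq> 0" using s z by auto
  note D = idD [OF sat, unfolded pw_simps t]
  note D1 = D [of "cq 0 1"] and D2 = D [of "cq 1 1"] and D3 = D [of "cq (1 + \<i>) 1"]
  note simps = cq_simps cq_eq_iff nz
  consider "(p, q, r) \<in> {(1,1,1), (1,2,1), (2,1,2)}" | "(p, q, r) = (1,1,2)" | "(p, q, r) = (1,2,2)"
    using pqr by auto
  then show ?thesis
  proof cases
    case 1
    have "z * cnj s = s * cnj z"
      using 1 D1 D2 by (auto simp: simps algebra_simps)
    moreover have "s * z = cnj s * cnj z"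
      using 1 D1 D2 by (auto simp: simps algebra_simps)
    ultimately have "(z = 1 \<or> z = - 1 \<or> z = \<i> \<or> z = - \<i>) \<and> (s = z \<or> s = - z)"
      by (intro unit_pair_real_products z s)
    \<comment> \<open>The two reality conditions leave z = i and z = -i open; the third point 1 + i
      + j excludes them.\<close>
    moreover have "z \<noteq> \<i>" "z \<noteq> - \<i>" if "s = z \<or> s = - z"
      using 1 D3 that by (auto simp: simps complex_eq_iff)
    ultimately show ?thesis using t by auto
  next
    case 2
    have "cnj z = z" using 2 D1 by (auto simp: simps)
    then have z1: "z = 1 \<or> z = - 1" using z cnj_fixed_unit by blast
    then have "s * s = 1" using 2 D2 s by (auto simp: simps algebra_simps)
    then show ?thesis using z1 t by (metis power2_eq_square power2_eq_1_iff)
  next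
    case 3
    have "cnj z = z" using 3 D1 by (auto simp: simps)
    moreover have "cnj s = s" using 3 D2 by (auto simp: simps algebra_simps)
    ultimately show ?thesis using z s t cnj_fixed_unit by blast
  qed
qed

text \<open>At the point i, exponents (1,1,1) and (1,2,1) leave conj(b) = conj(i) conj(b) i, so
  \<open>b\<close> commutes with i.\<close>

lemma topstar_isotope_circle:
  assumes sat: "sat (topstar_isotope (cq z 0) (cq s t)) p q r"
    and pqr: "(p, q, r) \<in> {(1,1,1), (1,2,1), (2,1,2)}"
  shows "t = 0"
proof -
  obtain \<rho> :: complex where \<rho>: "\<rho> * cnj \<rho> = 1" "\<rho> * \<rho> * \<rho> * \<rho> \<noteq> 1"
    by (rule generic_unit)
  let ?a = "cq z 0" and ?b = "cq s t"
  have i: "\<i> * cnj \<i> = 1" by simp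
  note D = topstarD [OF sat, of "cq w 0" for w, unfolded pw_simps]
  have *: "t = 0" if "qcnj ?b = qcnj (cq \<i> 0) * qcnj ?b * cq \<i> 0"
    using that by (simp add: cq_simps cq_eq_iff)
  from pqr consider "p = 1" "q = 1" "r = 1" | "p = 1" "q = 2" "r = 1" | "p = 2" "q = 1" "r = 2"
    by auto
  then show ?thesis
  proof cases
    case 1
    show ?thesis
    proof (rule *, rule cancel_both [where l = 1])
      let ?x = "cq \<i> 0"
      show "1 * qcnj ?b * (qcnj ?a * ?x) = 1 * (qcnj ?x * qcnj ?b * ?x) * (qcnj ?a * ?x)"
        using D [of \<i>] by (simp add: 1 circle_simps [OF i] cancel_simps)
    qed (simp_all add: norm_simps)
  next
    case 2
    show ?thesis
    proof (rule *, rule cancel_both [where l = 1])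
      let ?x = "cq \<i> 0"
      show "1 * qcnj ?b * (?a * qcnj ?x * qcnj ?x * ?b * qcnj ?a) =
          1 * (qcnj ?x * qcnj ?b * ?x) * (?a * qcnj ?x * qcnj ?x * ?b * qcnj ?a)"
        using D [of \<i>] by (simp add: 2 circle_simps [OF i] cancel_simps)
    qed (simp_all add: norm_simps)
  next
    case 3
    have E: "?b * qcnj ?a * qcnj ?b * cq w 0 =
        cq w 0 * cq w 0 * cq w 0 * qcnj ?a * qcnj ?a * qcnj ?b * ?a * qcnj (cq w 0) * qcnj (cq w 0) * ?b"
      if w: "w * cnj w = 1" for w
    proof (rule cancel_both)
      let ?x = "cq w 0"
      show "(qcnj ?b * ?a * qcnj ?x) * (?b * qcnj ?a * qcnj ?b * ?x) * (?x * qcnj ?a) =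
          (qcnj ?b * ?a * qcnj ?x) * (?x * ?x * ?x * qcnj ?a * qcnj ?a * qcnj ?b * ?a *
            qcnj ?x * qcnj ?x * ?b) * (?x * qcnj ?a)"
        using D [of w] by (simp add: 3 circle_simps [OF w] cancel_simps w)
    qed (simp_all add: norm_simps w)
    \<comment> \<open>After the terms in \<open>s\<close> cancel, the two sides turn with
      \<open>w\<close> at the rates 1 and 5.\<close>
    have "t * cnj t * (z * w) = t * cnj t * (cnj z * cnj z * cnj z * w * w * w * w * w)"
      if w: "w * cnj w = 1" for w
    proof -
      have "(s * cnj z * cnj s + t * z * cnj t) * w =
          w * w * w * cnj z * cnj z * (cnj s * z * cnj w * cnj w * s + t * cnj z * w * w * cnj t)"
        using E [OF w] by (simp add: cq_simps cq_eq_iff algebra_simps)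
      then show ?thesis using w z by algebra
    qed
    from this [of 1] this [OF \<rho>(1)] have "t * cnj t * z * (\<rho> * \<rho> * \<rho> * \<rho> - 1) = 0"
      using \<rho>(1) by simp algebra
    then show ?thesis using \<rho>(2) z_nz by simp
  qed
qed

lemma topstar_isotope_complex:
  assumes sat: "sat (topstar_isotope (cq z 0) (cq s t)) p q r"
    and pqr: "(p, q, r) \<in> {(1,1,1), (1,2,1), (2,1,2)}"
  shows "(z = 1 \<or> z = - 1) \<and> t = 0 \<and> (s = 1 \<or> s = - 1)"
proof -
  have t: "t = 0" by (rule topstar_isotope_circle [OF assms])
  have s: "s * cnj s = 1" using st t by simp
  have nz: "s \<noteq> 0" "z \<noteq> 0" using s z by auto
  note D = topstarD [OF sat, unfolded pw_simps t]
  note D1 = D [of "cq 0 1"] and D2 = D [of "cq 1 1"] and D3 = D [of "cq (1 + \<i>) 1"]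
  note simps = cq_simps cq_eq_iff nz
  have "z * cnj s = s * cnj z"
    using pqr D1 D2 by (auto simp: simps algebra_simps)
  moreover have "s * z = cnj s * cnj z"
    using pqr D1 D2 by (auto simp: simps algebra_simps)
  ultimately have "(z = 1 \<or> z = - 1 \<or> z = \<i> \<or> z = - \<i>) \<and> (s = z \<or> s = - z)"
    by (intro unit_pair_real_products z s)
  moreover have "z \<noteq> \<i>" "z \<noteq> - \<i>" if "s = z \<or> s = - z"
    using pqr D3 that by (auto simp: simps complex_eq_iff)
  ultimately show ?thesis using t by auto
qed

lemma topstar_isotope_112: "\<not> sat (topstar_isotope (cq z 0) (cq s t)) 1 1 2"
proof
  assume sat: "sat (topstar_isotope (cq z 0) (cq s t)) 1 1 2"
  obtain \<rho> :: complex where \<rho>: "\<rho> * cnj \<rho> = 1" "cnj \<rho> * cnj \<rho> \<noteq> \<rho> * \<rho>"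
    "\<rho> * \<rho> * \<rho> * \<rho> \<noteq> 1"
    by (rule generic_unit)
  let ?a = "cq z 0" and ?b = "cq s t"
  note D = topstarD [OF sat, of "cq w 0" for w, unfolded pw_simps]
  have E: "cnj s * cnj s * (w * w * w) * cnj z - t * cnj t * cnj w * z =
      s * cnj s * z * (cnj w * cnj w * cnj w) + t * cnj t * cnj z * w"
    if w: "w * cnj w = 1" for w
  proof -
    let ?x = "cq w 0"
    have "qcnj ?b * ?x * ?x * qcnj ?a * qcnj ?b * ?x = qcnj ?x * qcnj ?b * ?a * qcnj ?x * qcnj ?x * ?b"
    proof (rule cancel_both [where l = 1])
      show "1 * (qcnj ?b * ?x * ?x * qcnj ?a * qcnj ?b * ?x) * (?x * qcnj ?a) =
          1 * (qcnj ?x * qcnj ?b * ?a * qcnj ?x * qcnj ?x * ?b) * (?x * qcnj ?a)"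
        using D [of w] by (simp add: circle_simps [OF w] cancel_simps w)
    qed (simp_all add: norm_simps w)
    then have "(cnj s * w * w * cnj z) * (cnj s * w) - t * cnj w * cnj w * z * (cnj t * w) =
        cnj w * (cnj s * z * cnj w * cnj w) * s + cnj w * (t * cnj z * w * w) * cnj t"
      by (simp add: cq_simps cq_eq_iff algebra_simps)
    then show ?thesis using w by algebra
  qed
  \<comment> \<open>Divided by i, the equation at w = i has the right-hand side of the one at w = 1
    and the opposite left-hand side, so both sides vanish at w = 1.\<close>
  have *: "cnj s * cnj s * cnj z = t * cnj t * z" "s * cnj s * z = - (t * cnj t * cnj z)"
  proof -
    have 1: "cnj s * cnj s * cnj z - t * cnj t * z = s * cnj s * z + t * cnj t * cnj z"
      using E [of 1] by simp
    have "cnj s * cnj s * (\<i> * \<i> * \<i>) * cnj z - t * cnj t * (- \<i>) * z =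
        s * cnj s * z * (- \<i> * - \<i> * - \<i>) + t * cnj t * cnj z * \<i>"
      using E [of \<i>] by simp
    moreover have "\<i> * \<i> = - 1" by simp
    ultimately have 2: "- (cnj s * cnj s * cnj z) + t * cnj t * z = s * cnj s * z + t * cnj t * cnj z"
      by algebra
    show "cnj s * cnj s * cnj z = t * cnj t * z" "s * cnj s * z = - (t * cnj t * cnj z)"
      using 1 2 by algebra+
  qed
  have "t \<noteq> 0" using * st z_nz by auto
  \<comment> \<open>With these relations \<open>E\<close> factors. At \<open>\<rho>\<close> and at
    its conjugate the last factor is nonzero, so z w^2 = conj(z) holds for both, against the choice
    of \<open>\<rho>\<close>.\<close>
  have "t * cnj t * (z * (w * w) - cnj z) * (w * w * w * w - 1) = 0" if w: "w * cnj w = 1" for w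
    using E [OF w] * w by algebra
  from this [OF \<rho>(1)] this [of "cnj \<rho>"] \<rho> \<open>t \<noteq> 0\<close>
  have "z * (\<rho> * \<rho>) = cnj z" "z * (cnj \<rho> * cnj \<rho>) = cnj z"
    by (auto simp: mult.commute) (metis complex_cnj_cnj complex_cnj_mult complex_cnj_one)+
  then show False using \<rho>(2) z_nz by (metis mult_left_cancel)
qed

lemma topstar_isotope_122: "\<not> sat (topstar_isotope (cq z 0) (cq s t)) 1 2 2"
proof
  assume sat: "sat (topstar_isotope (cq z 0) (cq s t)) 1 2 2"
  obtain \<rho> :: complex where \<rho>: "\<rho> * cnj \<rho> = 1" "\<rho> * \<rho> * \<rho> * \<rho> * \<rho> * \<rho> \<noteq> 1"
    by (rule generic_unit)
  let ?a = "cq z 0" and ?b = "cq s t"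
  note D = topstarD [OF sat, of "cq w 0" for w, unfolded pw_simps]
  let ?l = "\<lambda>x. ?a * qcnj x * qcnj x * ?b * x * qcnj ?a * qcnj ?b * x * x"
  let ?r = "\<lambda>x. qcnj x * qcnj ?b * ?a * qcnj x * qcnj x * ?b * ?a * qcnj x * qcnj x * ?b"
  have E: "qcnj ?b * ?l (cq w 0) = ?r (cq w 0)" if w: "w * cnj w = 1" for w
  proof (rule cancel_both [where l = 1])
    show "1 * (qcnj ?b * ?l (cq w 0)) * qcnj ?a = 1 * ?r (cq w 0) * qcnj ?a"
      using D [of w] by (simp add: circle_simps [OF w] cancel_simps w)
  qed (simp_all add: norm_simps)
  have "qcnj ?a * qcnj ?b = ?a * ?b"
  proof (rule cancel_both [where r = 1])
    show "(qcnj ?b * ?a * ?b) * (qcnj ?a * qcnj ?b) * 1 = (qcnj ?b * ?a * ?b) * (?a * ?b) * 1"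
      using E [of 1] by (simp add: cq_1 mult.assoc)
  qed (simp_all add: norm_simps)
  then have zs: "cnj z * cnj s = z * s" and zt: "- (cnj z * t) = z * t"
    by (simp_all add: cq_simps cq_eq_iff)
  show False
  proof (cases "t = 0")
    case True
    then have s: "s * cnj s = 1" using st by simp
    have "cnj s * w * w * w * w * w * w = z * z * s" if w: "w * cnj w = 1" for w
    proof -
      have "cnj s * (z * cnj w * cnj w * s * w * cnj z * cnj s * w * w) =
          cnj w * cnj s * z * cnj w * cnj w * s * z * cnj w * cnj w * s"
        using E [OF w] by (simp add: True cq_simps cq_eq_iff mult.assoc)
      then show ?thesis using w s z by algebra
    qed
    from this [of 1] this [OF \<rho>(1)] s have "\<rho> * \<rho> * \<rho> * \<rho> * \<rho> * \<rho> = 1"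
      by simp algebra
    then show False using \<rho>(2) by contradiction
  next
    case False
    then have z': "cnj z = - z" using zt by (metis minus_mult_left mult_right_cancel minus_equation_iff)
    then have "z * z = - 1" using z by (metis minus_mult_right minus_minus)
    then have zi: "z = \<i> \<or> z = - \<i>" by (rule square_eq_minus_one)
    have "z * (cnj s + s) = 0" using zs z' by algebra
    then have s': "cnj s = - s" using z_nz by (simp add: eq_neg_iff_add_eq_0)
    \<comment> \<open>The points j and k leave s^2 times the real and the imaginary part of
      \<open>t\<close>, so s = 0; then b = t j is excluded at the point i.\<close>
    note D' = topstarD [OF sat, unfolded pw_simps]
    have "2 * \<i> * s * s * (t + cnj t) = 0"
      using zi D' [of "cq 0 1"] s' by (auto simp: cq_simps cq_eq_iff algebra_simps)
    moreover have "2 * \<i> * s * s * (t - cnj t) = 0"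
      using zi D' [of "cq 0 \<i>"] s' by (auto simp: cq_simps cq_eq_iff algebra_simps)
    ultimately have s0: "s = 0" using False by (auto simp: eq_neg_iff_add_eq_0 [symmetric])
    then have "t * cnj t = 1" using st by simp
    then show False
      using zi D' [of "cq \<i> 0"] s0 by (auto simp: cq_simps cq_eq_iff algebra_simps)
  qed
qed

end

section \<open>The family conj(x) a y b\<close>

lemma lstar_isotope_satD:
  assumes "sat (lstar_isotope a b) p q r" "norm a = 1" "norm b = 1"
  shows "qcnj b * qcnj (pw (lstar_isotope a b) q x) * qcnj a * pw (lstar_isotope a b) p x * a *
      pw (lstar_isotope a b) r x =
    qcnj (pw (lstar_isotope a b) p x) * a * qcnj (pw (lstar_isotope a b) q x) * a *
      pw (lstar_isotope a b) r x * b"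
  using assms by (simp add: sat_def lstar_isotope_associator)

lemma i_mult_eq_neg:
  "\<i> * x = - (\<i> * y) \<longleftrightarrow> y = - x" "- (\<i> * x) = \<i> * y \<longleftrightarrow> y = - x"
  "- (x * \<i>) = \<i> * y \<longleftrightarrow> y = - x" "x * \<i> = - (\<i> * y) \<longleftrightarrow> y = - x"
proof -
  have *: "\<i> * x = - (\<i> * y) \<longleftrightarrow> y = - x" for x y
    by (metis complex_i_not_zero minus_minus mult_left_cancel mult_minus_right)
  show "\<i> * x = - (\<i> * y) \<longleftrightarrow> y = - x" "- (\<i> * x) = \<i> * y \<longleftrightarrow> y = - x"
    "- (x * \<i>) = \<i> * y \<longleftrightarrow> y = - x" "x * \<i> = - (\<i> * y) \<longleftrightarrow> y = - x"
    using * [of x y] * [of "- x" "- y"] minus_equation_iff [of y x]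
    by (auto simp: mult.commute [of x])
qed

context complex_parameter
begin

lemmas lstarD = lstar_isotope_satD [OF _ unit_a unit_b]

lemma lstar_isotope_111: "\<not> sat (lstar_isotope (cq z 0) (cq s t)) 1 1 1"
proof
  assume sat: "sat (lstar_isotope (cq z 0) (cq s t)) 1 1 1"
  let ?a = "cq z 0" and ?b = "cq s t"
  note D = lstarD [OF sat, unfolded pw_simps]
  have E: "qcnj ?b * cq w 0 = ?a * ?a * qcnj (cq w 0) * ?b" if w: "w * cnj w = 1" for w
    using D [of "cq w 0"] by (simp add: circle_simps [OF w] cancel_simps w)
  have 1: "cnj s = z * z * s" "- t = z * z * t"
    using E [of 1] by (simp_all add: cq_simps cq_eq_iff)
  \<comment> \<open>Between w = 1 and w = i the complex coordinate of one side changes sign relative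
    to the other, so s = 0.\<close>
  moreover have "cnj s * \<i> = - (z * z * \<i> * s)"
    using E [of \<i>] by (simp add: cq_simps cq_eq_iff)
  then have "\<i> * (cnj s + z * z * s) = 0" by algebra
  then have "cnj s = - (z * z * s)" by (simp add: eq_neg_iff_add_eq_0)
  ultimately have s: "s = 0" using z_nz by simp
  then have t: "t * cnj t = 1" using st by simp
  then have "z * z = - 1" using 1(2) by algebra
  then have z: "z = \<i> \<or> z = - \<i>" by (rule square_eq_minus_one)
  \<comment> \<open>The points j and k impose contradictory conditions on \<open>t\<close>.\<close>
  have "cnj t = - t"
    using z D [of "cq 0 1"] s by (auto simp: cq_simps cq_eq_iff i_mult_eq_neg)
  moreover have "cnj t = t"
    using z D [of "cq 0 \<i>"] s by (auto simp: cq_simps cq_eq_iff)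
  ultimately show False using t by auto
qed

lemma lstar_isotope_121: "\<not> sat (lstar_isotope (cq z 0) (cq s t)) 1 2 1"
proof
  assume sat: "sat (lstar_isotope (cq z 0) (cq s t)) 1 2 1"
  let ?a = "cq z 0" and ?b = "cq s t"
  obtain \<rho> :: complex where \<rho>: "\<rho> * cnj \<rho> = 1" "\<rho> * \<rho> * \<rho> * \<rho> \<noteq> 1"
    by (rule generic_unit)
  note D = lstarD [OF sat, unfolded pw_simps]
  have E: "qcnj ?b * qcnj ?b * qcnj ?a * cq w 0 * cq w 0 = qcnj (cq w 0) * ?a * qcnj ?b * cq w 0 * ?b"
    if w: "w * cnj w = 1" for w
    using D [of "cq w 0"] by (simp add: circle_simps [OF w] cancel_simps w)
  have "qcnj ?b * qcnj ?b * qcnj ?a = ?a"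
    using E [of 1] by (simp add: cq_1 cancel_simps)
  then have E': "?a * cq w 0 * cq w 0 = qcnj (cq w 0) * ?a * qcnj ?b * cq w 0 * ?b"
    if w: "w * cnj w = 1" for w
    using E [OF w] by simp
  have F: "z * w * w = cnj w * z * (cnj s * w * s + t * cnj w * cnj t)"
    if w: "w * cnj w = 1" for w
    using E' [OF w] by (simp add: cq_simps cq_eq_iff algebra_simps)
  have i: "\<i> * cnj \<i> = 1" by simp
  \<comment> \<open>At w = i, \<open>F\<close> reads -1 = |s|^2 - |t|^2, while |s|^2 + |t|^2 = 1. So
    s = 0, and \<open>F\<close> becomes w^4 = 1 on the whole circle.\<close>
  have "z * \<i> * \<i> = - \<i> * z * (cnj s * \<i> * s + t * - \<i> * cnj t)"
    using F [OF i] unfolding complex_cnj_i .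
  then have "s * cnj s = 0"
    using st z i_squared unfolding power2_eq_square by algebra
  then have "t * cnj t = 1" using st by simp
  then have "\<rho> * \<rho> * \<rho> * \<rho> = 1"
    using F [OF \<rho>(1)] \<open>s * cnj s = 0\<close> \<rho>(1) z by algebra
  then show False using \<rho>(2) by contradiction
qed

text \<open>On the circle the identity has a left side independent of the point and a right side led
  by conj(x)^2, which is 1 at x = 1 and -1 at x = i.\<close>

lemma lstar_isotope_112: "\<not> sat (lstar_isotope (cq z 0) (cq s t)) 1 1 2"
proof
  assume sat: "sat (lstar_isotope (cq z 0) (cq s t)) 1 1 2"
  let ?a = "cq z 0" and ?b = "cq s t"
  note D = lstarD [OF sat, unfolded pw_simps]
  have E: "qcnj ?b * ?a * ?b = qcnj (cq w 0) * (qcnj (cq w 0) * (?a * ?a * ?a * ?b * ?b))"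
    if w: "w * cnj w = 1" for w
    using D [of "cq w 0"] by (simp add: circle_simps [OF w] cancel_simps w)
  have ii: "qcnj (cq \<i> 0) * (qcnj (cq \<i> 0) * y) = - y" for y
    by (simp add: cq_simps cq_minus_1 flip: mult.assoc)
  have "?a * ?a * ?a * ?b * ?b = - (?a * ?a * ?a * ?b * ?b)"
    using E [of 1] E [of \<i>] by (simp add: cq_1 ii)
  then have "2 *\<^sub>R (?a * ?a * ?a * ?b * ?b) = 0"
    by (simp only: scaleR_2 eq_neg_iff_add_eq_0)
  then have "?a * ?a * ?a * ?b * ?b = 0" by simp
  moreover have "norm (?a * ?a * ?a * ?b * ?b) = 1" by (simp add: norm_simps)
  ultimately show False by simp
qed

lemma lstar_isotope_122: "\<not> sat (lstar_isotope (cq z 0) (cq s t)) 1 2 2"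
proof
  assume sat: "sat (lstar_isotope (cq z 0) (cq s t)) 1 2 2"
  let ?a = "cq z 0" and ?b = "cq s t"
  note D = lstarD [OF sat, unfolded pw_simps]
  have E: "qcnj ?b * qcnj ?b * cq w 0 * ?b = qcnj (cq w 0) * ?a * qcnj ?b * ?a * ?b * ?b"
    if w: "w * cnj w = 1" for w
    using D [of "cq w 0"] by (simp add: circle_simps [OF w] cancel_simps w)
  have 1: "qcnj ?b = ?a * qcnj ?b * ?a * ?b * ?b"
    using E [of 1] by (simp add: cq_1 cancel_simps)
  have "qcnj ?b * qcnj ?b * cq \<i> 0 * ?b = qcnj (cq \<i> 0) * qcnj ?b"
    using E [of \<i>] by (subst 1) (simp add: mult.assoc)
  then have "?b * (?b * (qcnj ?b * (qcnj ?b * (cq \<i> 0 * ?b)))) * ?b =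
      ?b * (?b * (qcnj (cq \<i> 0) * qcnj ?b)) * ?b"
    by (simp add: mult.assoc)
  \<comment> \<open>b^2 anticommutes with i, so its complex coordinate s^2 - t conj(t) is
    zero.\<close>
  then have "cq \<i> 0 * ?b * ?b = - (?b * ?b * cq \<i> 0)"
    by (simp add: cancel_simps) (simp add: cq_simps cq_eq_iff algebra_simps)
  then have ss: "s * s = t * cnj t"
    by (simp add: cq_simps cq_eq_iff algebra_simps)
  show False
  proof (cases "s = 0")
    case True
    then show False using ss st by simp
  next
    case False
    have "(cmod s)\<^sup>2 = (cmod t)\<^sup>2"
      using ss by (metis norm_mult complex_mod_cnj power2_eq_square)
    then have "s * cnj s = t * cnj t" by (metis complex_norm_square)
    then have s': "cnj s = s" using ss False by (metis mult_left_cancel)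
    have half: "2 * (s * s) = 1" using st ss s' by simp
    have "z * z * t = - t"
      using 1 s' ss half by (simp add: cq_simps cq_eq_iff) algebra
    moreover have "t \<noteq> 0" using ss False by auto
    ultimately have "z * z = - 1" by (metis mult_minus_left mult_right_cancel mult_1)
    then have z: "z = \<i> \<or> z = - \<i>" by (rule square_eq_minus_one)
    have "cnj t = - t"
      using z D [of "cq 0 1"] s' ss half by (auto simp: cq_simps cq_eq_iff algebra_simps i_mult_eq_neg)
    moreover have "cnj t = t"
      using z D [of "cq 0 \<i>"] s' ss half by (auto simp: cq_simps cq_eq_iff algebra_simps)
    ultimately show False using \<open>t \<noteq> 0\<close> by auto
  qed
qed

text \<open>In the j-coordinate the cancelled identity holds with opposite signs at x = 1 and at x =
  i.\<close>

lemma lstar_isotope_211_221_circle: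
  assumes sat: "sat (lstar_isotope (cq z 0) (cq s t)) 2 q 1"
    and "q \<in> {1, 2}"
  shows "t = 0"
proof -
  let ?a = "cq z 0" and ?b = "cq s t"
  note D = lstarD [OF sat, of "cq w 0" for w, unfolded pw_simps]
  consider "q = 1" | "q = 2" using assms(2) by auto
  then show ?thesis
  proof cases
    case 1
    have "qcnj (cq w 0) * ?b * ?a * cq w 0 = ?a * ?b" if w: "w * cnj w = 1" for w
    proof (rule cancel_both [where r = 1])
      let ?x = "cq w 0"
      show "qcnj ?b * (qcnj ?x * ?b * ?a * ?x) * 1 = qcnj ?b * (?a * ?b) * 1"
        using D [of w] by (simp add: 1 circle_simps [OF w] cancel_simps w)
    qed (simp_all add: norm_simps)
    from this [of 1] this [of \<i>] have "t * cnj z = z * t" "- (t * cnj z) = z * t"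
      by (auto simp: cq_simps cq_eq_iff algebra_simps)
    then have "2 * (z * t) = 0" by algebra
    then show ?thesis using z_nz by simp
  next
    case 2
    have "qcnj ?a * ?b * ?a * cq w 0 = cq w 0 * ?b" if w: "w * cnj w = 1" for w
    proof (rule cancel_both [where r = 1])
      let ?x = "cq w 0"
      show "(qcnj ?b * qcnj ?b) * (qcnj ?a * ?b * ?a * ?x) * 1 = (qcnj ?b * qcnj ?b) * (?x * ?b) * 1"
        using D [of w] by (simp add: 2 circle_simps [OF w] cancel_simps w)
    qed (simp_all add: norm_simps)
    from this [of 1] this [of \<i>] have "cnj z * t * cnj z = t"
      "cnj z * t * cnj z * \<i> = - (\<i> * t)"
      by (auto simp: cq_simps cq_eq_iff minus_equation_iff)
    then have "t * \<i> = - (\<i> * t)" by metis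
    then have "t = - t" by (simp add: i_mult_eq_neg)
    then show ?thesis by simp
  qed
qed

text \<open>At x = 1 the identity says that \<open>b\<close> commutes with a^2, so \<open>b\<close>
  is complex or a^2 is real.\<close>

lemma lstar_isotope_212_222_circle:
  assumes sat: "sat (lstar_isotope (cq z 0) (cq s t)) 2 q 2"
    and "q \<in> {1, 2}"
  shows "t = 0 \<or> z = 1 \<or> z = - 1 \<or> z = \<i> \<or> z = - \<i>"
proof -
  let ?a = "cq z 0" and ?b = "cq s t"
  have 1: "1 * cnj 1 = (1 :: complex)" by simp
  note D = lstarD [OF sat, of "cq 1 0", unfolded pw_simps]
  consider "q = 1" | "q = 2" using assms(2) by auto
  then have "?b * ?a * ?a = ?a * ?a * ?b"
  proof cases
    case 1
    have D': "?a * ?a * ?b = qcnj ?b * (?a * ?a * ?b * ?b)"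
      using D by (simp (no_asm_use) add: 1 cq_1 cancel_simps)
    have "?b * (?a * ?a * ?b) = ?a * ?a * ?b * ?b"
      by (subst D') (simp only: unit_cancel(4) [OF unit_b])
    then show ?thesis
      by (intro cancel_both [of 1 "?b * ?a * ?a" ?b]) (simp_all add: norm_simps mult.assoc)
  next
    case 2
    show ?thesis
    proof (rule cancel_both)
      show "(qcnj ?b * qcnj ?b * qcnj ?a) * (?b * ?a * ?a) * ?b =
          (qcnj ?b * qcnj ?b * qcnj ?a) * (?a * ?a * ?b) * ?b"
        using D by (simp add: 2 cq_1 cancel_simps)
    qed (simp_all add: norm_simps)
  qed
  then have "t * (cnj z * cnj z - z * z) = 0"
    by (simp add: cq_simps cq_eq_iff algebra_simps)
  then have "t = 0 \<or> (z * z) * (z * z) = 1"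
    using z by auto algebra
  then have "t = 0 \<or> z * z = 1 \<or> z * z = - 1"
    by (metis power2_eq_square power2_eq_1_iff)
  then show ?thesis using square_eq_minus_one by (metis power2_eq_square power2_eq_1_iff)
qed

end

lemma quat_cancel_both:
  assumes "l * x * r = l * y * (r :: quat)" "l \<noteq> 0" "r \<noteq> 0"
  shows "x = y"
proof -
  have "l * (x - y) * r = 0" using assms(1) by (simp add: algebra_simps)
  then show ?thesis using assms(2,3) by (simp add: norm_eq_0_quat_mult)
qed

context complex_parameter
begin

lemma z_cnj_cancel: "z * (cnj z * y) = y"
  using z by (simp flip: mult.assoc)

text \<open>The point j makes s real, and 1 + j then gives z^2 = 1.\<close>

lemma lstar_isotope_211:
  assumes sat: "sat (lstar_isotope (cq z 0) (cq s t)) 2 1 1"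
  shows "(z = 1 \<or> z = - 1) \<and> t = 0 \<and> (s = 1 \<or> s = - 1)"
proof -
  have t: "t = 0" by (rule lstar_isotope_211_221_circle [OF sat]) simp
  have s: "s * cnj s = 1" using st t by simp
  then have nz: "s \<noteq> 0" by auto
  note D = lstarD [OF sat, unfolded pw_simps t]
  have "cnj s = s" using D [of "cq 0 1"] nz z_nz by (auto simp: cq_simps cq_eq_iff)
  then have s1: "s = 1 \<or> s = - 1" using s cnj_fixed_unit by blast
  have "2 * z + 2 * (cnj z * cnj z * cnj z) = 2 * (z * z * z) + 2 * cnj z \<and> 2 * cnj z + 2 * z = 2 * (z * z * z) + 2 * (cnj z * cnj z * cnj z)"
    using D [of "cq 1 1"] s1 by (auto simp: cq_simps cq_eq_iff algebra_simps z_cnj_cancel)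
  then have "z * z = 1" using z by algebra
  then show ?thesis using t s1 by (metis power2_eq_square power2_eq_1_iff)
qed

text \<open>The point j gives s^2 = z^4, and 1 + j gives z^4 = 1. So z = i and z = -i remain, with s
  equal to z^2 up to sign.\<close>

lemma lstar_isotope_221:
  assumes sat: "sat (lstar_isotope (cq z 0) (cq s t)) 2 2 1"
  shows "(z = 1 \<or> z = - 1 \<or> z = \<i> \<or> z = - \<i>) \<and> t = 0 \<and> (s = 1 \<or> s = - 1)"
proof -
  have t: "t = 0" by (rule lstar_isotope_211_221_circle [OF sat]) simp
  have s: "s * cnj s = 1" using st t by simp
  then have nz: "s \<noteq> 0" by auto
  note D = lstarD [OF sat, unfolded pw_simps t]
  have "s * (cnj z * cnj z) = z * (z * cnj s)"
    using D [of "cq 0 1"] nz z_nz by (auto simp: cq_simps cq_eq_iff algebra_simps)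
  then have "s * s = (z * z) * (z * z)" using s z by algebra
  then have s1: "s = z * z \<or> s = - (z * z)" by (metis power2_eq_square power2_eq_iff)
  have "(z * z) * (z * z) = 1"
    using s1
  proof
    assume "s = z * z"
    then show ?thesis
      using D [of "cq 1 1"] by (simp add: cq_simps cq_eq_iff algebra_simps z_cnj_cancel) (use z in algebra)
  next
    assume "s = - (z * z)"
    then show ?thesis
      using D [of "cq 1 1"] by (simp add: cq_simps cq_eq_iff algebra_simps z_cnj_cancel) (use z in algebra)
  qed
  then have "z * z = 1 \<or> z * z = - 1" by (metis power2_eq_square power2_eq_1_iff)
  then show ?thesis
    using s1 t square_eq_minus_one by (metis power2_eq_square power2_eq_1_iff minus_minus)
qed

text \<open>For z = 1 or -1 the identity holds for every unit \<open>b\<close>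
  (\<open>sat_lstar_1\<close>, up to sign), so no point can restrict s and t; the points 1 + j, 1 +
  k and i + j serve to exclude every other \<open>z\<close>.\<close>

lemma lstar_isotope_212:
  assumes sat: "sat (lstar_isotope (cq z 0) (cq s t)) 2 1 2"
  shows "z = 1 \<or> z = - 1"
proof (rule ccontr)
  assume z1: "\<not> (z = 1 \<or> z = - 1)"
  then have zz: "z * z \<noteq> 1" by (metis power2_eq_square power2_eq_1_iff)
  let ?a = "cq z 0" and ?b = "cq s t"
  note D = lstarD [OF sat, unfolded pw_simps]
  have E: "qcnj x * ?a * x * ?b * ?a * qcnj x * ?a * x =
      x * ?a * qcnj x * ?a * qcnj x * ?a * x * ?b" if x: "x \<noteq> 0" for x
  proof (rule quat_cancel_both)
    show "(qcnj ?b * qcnj x * qcnj ?a) * (qcnj x * ?a * x * ?b * ?a * qcnj x * ?a * x) * ?b =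
      (qcnj ?b * qcnj x * qcnj ?a) * (x * ?a * qcnj x * ?a * qcnj x * ?a * x * ?b) * ?b"
      using D [of x] by (simp add: mult.assoc)
    have "norm (qcnj ?b * qcnj x * qcnj ?a) \<noteq> 0"
      using x by (simp add: norm_simps)
    then show "qcnj ?b * qcnj x * qcnj ?a \<noteq> 0" by auto
    show "?b \<noteq> 0" using unit_b by auto
  qed
  have nz: "cq 1 1 \<noteq> 0" "cq 1 \<i> \<noteq> 0" "cq \<i> 1 \<noteq> 0"
    by (simp_all add: cq_def zero_quat_def)
  have zi: "z = \<i> \<or> z = - \<i> \<Longrightarrow> cnj s = - s \<and> t = 0"
  proof -
    assume zi: "z = \<i> \<or> z = - \<i>"
    have "\<i> * (s * 4) + \<i> * (cnj s * 4) = 0" "\<i> * (t * 4) + \<i> * (cnj t * 4) = 0"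
      using zi E [OF nz(1)] by (auto simp: cq_simps cq_eq_iff algebra_simps)
    then have "\<i> * 4 * (cnj s + s) = 0" "\<i> * 4 * (cnj t + t) = 0" by algebra+
    then have "cnj s = - s \<and> cnj t = - t" by (simp add: eq_neg_iff_add_eq_0)
    moreover have "cnj t = t"
      using zi E [OF nz(2)] by (auto simp: cq_simps cq_eq_iff algebra_simps)
    ultimately show ?thesis by auto
  qed
  have t: "t = 0"
    using zi lstar_isotope_212_222_circle [OF sat] z1 by auto
  have s: "s * cnj s = 1" using st t by simp
  then have nzs: "s \<noteq> 0" by auto
  \<comment> \<open>The two coordinates at 1 + j. The first factors as (conj(s) + s) (z^2 - 1)^2 =
    0, and then the second as s (z^2 + 1) (z^2 - 1)^2 = 0.\<close>
  have 1: "s * (z * (z * cnj z)) + (z * (z * (cnj s * cnj z)) + (s * (cnj z * (cnj z * cnj z)) + cnj s * (cnj z * (cnj z * cnj z)))) =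
      s * (z * (cnj z * (cnj z * 2))) + z * (cnj s * (cnj z * (cnj z * 2)))"
    and 2: "s * (z * (z * z)) + (z * (cnj s * (cnj z * cnj z)) + z * (z * (cnj s * (cnj z * 2)))) =
      z * (z * (z * cnj s)) + (s * (z * (cnj z * cnj z)) + cnj s * (cnj z * (cnj z * (cnj z * 2))))"
    using E [OF nz(1)] t by (simp_all add: cq_simps cq_eq_iff algebra_simps)
  have "cnj s = - s"
  proof (rule ccontr)
    assume "cnj s \<noteq> - s"
    have "(cnj s + s) * (z * z - 1) * (z * z - 1) = 0" using 1 z by algebra
    then have "z * z = 1" using \<open>cnj s \<noteq> - s\<close> by (simp add: eq_neg_iff_add_eq_0)
    then show False using zz by contradiction
  qed
  then have "s * (z * z + 1) * ((z * z - 1) * (z * z - 1)) = 0" using 2 z by algebra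
  then have "z * z = - 1"
    using nzs zz by (simp add: eq_neg_iff_add_eq_0)
  then have "z = \<i> \<or> z = - \<i>" by (rule square_eq_minus_one)
  then have "cnj s = s"
    using E [OF nz(3)] t by (auto simp: cq_simps cq_eq_iff algebra_simps)
  then show False using \<open>cnj s = - s\<close> nzs by auto
qed

lemma lstar_isotope_222:
  assumes sat: "sat (lstar_isotope (cq z 0) (cq s t)) 2 2 2"
  shows "z = 1 \<or> z = - 1 \<or>
    (z = \<i> \<or> z = - \<i>) \<and> t = 0 \<and> (s = 1 \<or> s = - 1 \<or> s = \<i> \<or> s = - \<i>)"
proof (rule ccontr)
  assume neg: "\<not> ?thesis"
  note D = lstarD [OF sat, unfolded pw_simps]
  have zi: "z = \<i> \<or> z = - \<i>"
  proof (cases "t = 0")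
    case True
    then have "s * cnj s = 1" using st by simp
    then have "s \<noteq> 0" by auto
    then have "cnj z * cnj z = z * z"
      using D [of "cq 0 1"] z_nz True by (auto simp: cq_simps cq_eq_iff algebra_simps)
    then have "(z * z) * (z * z) = 1" using z by algebra
    then have "z * z = 1 \<or> z * z = - 1" by (metis power2_eq_square power2_eq_1_iff)
    then show ?thesis using neg square_eq_minus_one by (metis power2_eq_square power2_eq_1_iff)
  next
    case False
    then show ?thesis using lstar_isotope_212_222_circle [OF sat] neg by auto
  qed
  \<comment> \<open>For z = i the square of x is conj(x) i x b, and conj(x) i x is 2 k at 1 + j and
    - 2 j at 1 + k. Together these two points give conj(s) t = 0.\<close>
  have "\<i> * (s * (t * (cnj s * (cnj s * 16)))) + \<i> * (t * (t * (cnj s * (cnj t * 16)))) =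
      \<i> * (s * (s * (cnj s * (cnj t * 16)))) + \<i> * (s * (t * (cnj t * (cnj t * 16))))"
    using zi D [of "cq 1 1"] by (elim disjE) (simp_all add: cq_simps cq_eq_iff algebra_simps)
  then have "\<i> * 16 * (cnj s * t - s * cnj t) = 0" using st by algebra
  moreover have "s * (s * (cnj s * (cnj t * 16))) + (s * (t * (cnj s * (cnj s * 16))) +
      (s * (t * (cnj t * (cnj t * 16))) + t * (t * (cnj s * (cnj t * 16))))) = 0"
    using zi D [of "cq 1 \<i>"] by (elim disjE) (simp_all add: cq_simps cq_eq_iff algebra_simps)
  then have "16 * (cnj s * t + s * cnj t) = 0" using st by algebra
  ultimately have "s = 0 \<or> t = 0" using st by auto
  then show False
  proof
    \<comment> \<open>These points mix the components: conj(x) i x is 3 i + 4 k at 2 + j and 2 i - 4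
      j + 4 k at 2 + j + k. They equate t^2 with conj(t)^2 and with its negative.\<close>
    assume s: "s = 0"
    then have "t * cnj t = 1" using st by simp
    then have "t \<noteq> 0" by auto
    then have "t * t = cnj t * cnj t"
      using zi D [of "cq 2 1"] s by (auto simp: cq_simps cq_eq_iff algebra_simps)
    moreover have "t * (t * (t * (cnj t * 128))) + t * (cnj t * (cnj t * (cnj t * 128))) = 0"
      using zi D [of "cq 2 (1 + \<i>)"] s by (auto simp: cq_simps cq_eq_iff algebra_simps)
    then have "t * cnj t * 128 * (t * t + cnj t * cnj t) = 0" by algebra
    then have "t * t = - (cnj t * cnj t)" using \<open>t \<noteq> 0\<close> by (simp add: eq_neg_iff_add_eq_0)
    ultimately show False using \<open>t \<noteq> 0\<close> by auto
  next
    assume t: "t = 0"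
    then have s: "s * cnj s = 1" using st by simp
    then have "s \<noteq> 0" by auto
    then have "s * s = cnj s * cnj s"
      using zi D [of "cq 2 1"] t by (auto simp: cq_simps cq_eq_iff algebra_simps)
    then have "(s * s) * (s * s) = 1" using s by algebra
    then have "s * s = 1 \<or> s * s = - 1" by (metis power2_eq_square power2_eq_1_iff)
    then have "s = 1 \<or> s = - 1 \<or> s = \<i> \<or> s = - \<i>"
      using square_eq_minus_one by (metis power2_eq_square power2_eq_1_iff)
    then show False using neg zi t by auto
  qed
qed

end

section \<open>The classification\<close>

lemma isotope_conjugate:
  assumes "norm u = 1"
  shows "alg_isomorphic (id_isotope a b) (id_isotope (qcnj u * a * u) (qcnj u * b * u))"
    "alg_isomorphic (topstar_isotope a b) (topstar_isotope (qcnj u * a * u) (qcnj u * b * u))"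
    "alg_isomorphic (lstar_isotope a b) (lstar_isotope (qcnj u * a * u) (qcnj u * b * u))"
  by (rule alg_isomorphic_quatI [of "qcnj u" u],
      simp_all add: assms isotope_defs mult.assoc unit_cancel)+

lemma complex_parameter_exists:
  assumes "norm a = 1" "norm b = 1"
  obtains z s t where "complex_parameter z s t"
    "alg_isomorphic (id_isotope a b) (id_isotope (cq z 0) (cq s t))"
    "alg_isomorphic (topstar_isotope a b) (topstar_isotope (cq z 0) (cq s t))"
    "alg_isomorphic (lstar_isotope a b) (lstar_isotope (cq z 0) (cq s t))"
proof -
  obtain u where u: "norm u = 1" "qim2 (qcnj u * a * u) = 0" "qim3 (qcnj u * a * u) = 0"
    by (rule unit_conjugate_complex)
  obtain z where z: "qcnj u * a * u = cq z 0"
    using u(2,3) that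
    by (metis cq_def complex.sel zero_complex.sel quat.exhaust_sel)
  obtain s t where st: "qcnj u * b * u = cq s t" by (rule cq_cases)
  have "norm (cq z 0) = 1" "norm (cq s t) = 1"
    using assms u(1) by (simp_all add: norm_quat_mult flip: z st)
  then have "complex_parameter z s t"
    by unfold_locales (simp_all add: cq_unit)
  then show thesis
    using isotope_conjugate [OF u(1), of a b] unfolding z st by (rule that)
qed

text \<open>Multiplication by the central sign \<open>\<epsilon> * \<delta>\<close> is the
  isomorphism; parameters therefore matter only up to sign.\<close>

lemma isotope_sign:
  assumes "\<epsilon> = 1 \<or> \<epsilon> = - 1" "\<delta> = 1 \<or> \<delta> = - (1 :: quat)"
  shows "alg_isomorphic (id_isotope (\<epsilon> * a) (\<delta> * b)) (id_isotope a b)"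
    "alg_isomorphic (topstar_isotope (\<epsilon> * a) (\<delta> * b)) (topstar_isotope a b)"
    "alg_isomorphic (lstar_isotope (\<epsilon> * a) (\<delta> * b)) (lstar_isotope a b)"
    "alg_isomorphic (rstar_isotope (\<epsilon> * a) (\<delta> * b)) (rstar_isotope a b)"
  using assms
  by (intro alg_isomorphic_quatI [of "\<epsilon> * \<delta>" 1]; auto simp: isotope_defs)+

lemma isotope_1:
  "id_isotope 1 1 = (*)" "topstar_isotope 1 1 = topstar_mult"
  "lstar_isotope 1 1 = lstar_mult" "rstar_isotope 1 1 = rstar_mult"
  by (simp_all add: fun_eq_iff isotope_defs topstar_mult_def lstar_mult_def rstar_mult_def)

text \<open>The isomorphism is conjugation, which reverses the order of the factors once
  more.\<close>

lemma isotope_opposite: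
  "alg_isomorphic (\<lambda>x y. id_isotope a b y x) (id_isotope (qcnj b) (qcnj a))"
  "alg_isomorphic (\<lambda>x y. topstar_isotope a b y x) (topstar_isotope (qcnj b) (qcnj a))"
  "alg_isomorphic (\<lambda>x y. lstar_isotope a b y x) (rstar_isotope (qcnj b) (qcnj a))"
  "alg_isomorphic (\<lambda>x y. rstar_isotope a b y x) (lstar_isotope (qcnj b) (qcnj a))"
  by (rule alg_isomorphic_qcnjI, simp add: isotope_defs mult.assoc)+

lemma alg_isomorphic_opposite_trans:
  assumes "alg_isomorphic (\<lambda>x y. m y x) n" "alg_isomorphic (\<lambda>x y. n y x) n'"
  shows "alg_isomorphic m n'"
  using assms alg_isomorphic_opposite [of "\<lambda>x y. m y x" n] alg_isomorphic_trans by blast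

text \<open>Conjugated into the complex plane, \<open>y\<close> has a complex square root.\<close>

lemma quat_square_root: "\<exists>x. x * x = (y :: quat)"
proof -
  obtain u where u: "norm u = 1" "qim2 (qcnj u * y * u) = 0" "qim3 (qcnj u * y * u) = 0"
    by (rule unit_conjugate_complex)
  obtain z where z: "qcnj u * y * u = cq z 0"
    using u(2,3) by (metis cq_def complex.sel zero_complex.sel quat.exhaust_sel)
  have "(u * cq (csqrt z) 0 * qcnj u) * (u * cq (csqrt z) 0 * qcnj u) =
      u * (cq (csqrt z) 0 * cq (csqrt z) 0) * qcnj u"
    using u(1) by (simp add: mult.assoc unit_cancel)
  also have "cq (csqrt z) 0 * cq (csqrt z) 0 = cq z 0"
    using power2_csqrt [of z] by (simp add: cq_simps power2_eq_square)
  also have "u * cq z 0 * qcnj u = y"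
    using u(1) by (simp add: mult.assoc unit_cancel flip: z)
  finally show ?thesis by blast
qed

lemma sat_222_imp_111:
  assumes "sat m 2 2 2" "surj (sq m)"
  shows "sat m 1 1 1"
  unfolding sat_def
proof
  fix x
  obtain y where "x = sq m y" using assms(2) by blast
  then show "associator m (pw m 1 x) (pw m 1 x) (pw m 1 x) = 0"
    using assms(1) by (simp add: sat_def pw_def)
qed

text \<open>The equation a x x b = y asks for a square root of conj(a) y conj(b); for
  \<open>topstar_isotope\<close> the conjugate of that root works.\<close>

lemma surj_sq_isotope:
  assumes "norm a = 1" "norm b = 1"
  shows "surj (sq (id_isotope a b))" "surj (sq (topstar_isotope a b))"
proof -
  have "\<exists>x. y = sq (id_isotope a b) x \<and> y = sq (topstar_isotope a b) (qcnj x)" for y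
  proof -
    obtain x where "x * x = qcnj a * y * qcnj b" using quat_square_root by blast
    then have "a * x * x * b = y" using assms by (simp add: mult.assoc unit_cancel)
    then show ?thesis by (auto simp: sq_def isotope_defs)
  qed
  then show "surj (sq (id_isotope a b))" "surj (sq (topstar_isotope a b))"
    by (meson surjI surj_def)+
qed

lemma cq_i: "cq \<i> 0 = qi" "cq (- \<i>) 0 = - qi"
  by (simp_all add: cq_def qi_def uminus_quat_def)

lemma id_isotope_classification:
  assumes unit: "norm a = 1" "norm b = 1" and sat: "sat (id_isotope a b) p q r"
    and pqr: "p \<in> {1, 2}" "q \<in> {1, 2}" "r \<in> {1, 2}"
  shows "alg_isomorphic (id_isotope a b) ((*) :: quat \<Rightarrow> quat \<Rightarrow> quat)"
proof -
  have *: "alg_isomorphic (id_isotope a b) ((*) :: quat \<Rightarrow> quat \<Rightarrow> quat)"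
    if that': "sat (id_isotope a b) p q r" "(p, q, r) \<in> {(1,1,1), (1,2,1), (1,1,2), (1,2,2), (2,1,2)}"
      "norm a = 1" "norm b = 1" for a b p q r
  proof -
    obtain z s t where zst: "complex_parameter z s t"
      and iso: "alg_isomorphic (id_isotope a b) (id_isotope (cq z 0) (cq s t))"
      using complex_parameter_exists [OF that'(3,4)] by metis
    have "(z = 1 \<or> z = - 1) \<and> t = 0 \<and> (s = 1 \<or> s = - 1)"
      using that'(1,2) sat_isomorphic [OF iso] by (intro complex_parameter.id_isotope_complex [OF zst]) auto
    then have "cq z 0 = 1 \<or> cq z 0 = - 1" "cq s t = 1 \<or> cq s t = - 1"
      by (auto simp: cq_1 cq_minus_1)
    from isotope_sign(1) [OF this, of 1 1]
    have "alg_isomorphic (id_isotope (cq z 0) (cq s t)) ((*) :: quat \<Rightarrow> quat \<Rightarrow> quat)" by (simp add: isotope_1)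
    then show ?thesis by (rule alg_isomorphic_trans [OF iso])
  qed
  \<comment> \<open>(2,1,1) and (2,2,1) are opposite to (1,1,2) and (1,2,2), and (2,2,2) reduces to
    (1,1,1).\<close>
  consider "(p, q, r) \<in> {(1,1,1), (1,2,1), (1,1,2), (1,2,2), (2,1,2)}" |
    "(r, q, p) \<in> {(1,1,2), (1,2,2)}" | "(p, q, r) = (2,2,2)"
    using pqr by auto
  then show ?thesis
  proof cases
    case 1
    then show ?thesis using * sat unit by blast
  next
    case 2
    have "sat (id_isotope (qcnj b) (qcnj a)) r q p"
      using sat sat_opposite [of "id_isotope a b"] sat_isomorphic [OF isotope_opposite(1)] by blast
    then have "alg_isomorphic (id_isotope (qcnj b) (qcnj a)) ((*) :: quat \<Rightarrow> quat \<Rightarrow> quat)"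
      using 2 unit by (intro *) auto
    then have "alg_isomorphic (\<lambda>x y. id_isotope a b y x) (id_isotope 1 1)"
      unfolding isotope_1 by (rule alg_isomorphic_trans [OF isotope_opposite(1)])
    from alg_isomorphic_opposite_trans [OF this isotope_opposite(1)]
    show ?thesis by (simp add: isotope_1)
  next
    case 3
    then have "sat (id_isotope a b) 1 1 1"
      using sat by (intro sat_222_imp_111 surj_sq_isotope(1) unit) auto
    then show ?thesis using * unit by blast
  qed
qed

text \<open>Unequal outer exponents are impossible here: (1,q,2) is refuted directly, and (2,q,1) is
  its opposite.\<close>

lemma topstar_isotope_classification:
  assumes unit: "norm a = 1" "norm b = 1" and sat: "sat (topstar_isotope a b) p q r"
    and pqr: "p \<in> {1, 2}" "q \<in> {1, 2}" "r \<in> {1, 2}"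
  shows "p = r \<and> alg_isomorphic (topstar_isotope a b) topstar_mult"
proof -
  have *: "alg_isomorphic (topstar_isotope a b) topstar_mult"
    if "sat (topstar_isotope a b) p q r" "(p, q, r) \<in> {(1,1,1), (1,2,1), (2,1,2)}" for p q r
  proof -
    obtain z s t where zst: "complex_parameter z s t"
      and iso: "alg_isomorphic (topstar_isotope a b) (topstar_isotope (cq z 0) (cq s t))"
      using complex_parameter_exists [OF unit] by metis
    have "(z = 1 \<or> z = - 1) \<and> t = 0 \<and> (s = 1 \<or> s = - 1)"
      using that sat_isomorphic [OF iso]
      by (intro complex_parameter.topstar_isotope_complex [OF zst]) auto
    then have "cq z 0 = 1 \<or> cq z 0 = - 1" "cq s t = 1 \<or> cq s t = - 1"
      by (auto simp: cq_1 cq_minus_1)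
    from isotope_sign(2) [OF this, of 1 1]
    have "alg_isomorphic (topstar_isotope (cq z 0) (cq s t)) topstar_mult" by (simp add: isotope_1)
    then show ?thesis by (rule alg_isomorphic_trans [OF iso])
  qed
  have no: "\<not> sat (topstar_isotope a b) 1 q 2" if that': "norm a = 1" "norm b = 1" "q \<in> {1, 2}" for a b q
  proof -
    obtain z s t where zst: "complex_parameter z s t"
      and iso: "alg_isomorphic (topstar_isotope a b) (topstar_isotope (cq z 0) (cq s t))"
      using complex_parameter_exists [OF that'(1,2)] by metis
    show ?thesis
      using that'(3) sat_isomorphic [OF iso] complex_parameter.topstar_isotope_112 [OF zst]
        complex_parameter.topstar_isotope_122 [OF zst] by auto
  qed
  consider "(p, q, r) \<in> {(1,1,1), (1,2,1), (2,1,2)}" | "(p, q, r) = (2,2,2)" |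
    "p = 1" "r = 2" | "p = 2" "r = 1"
    using pqr by auto
  then show ?thesis
  proof cases
    case 1
    then show ?thesis using * [OF sat 1] by auto
  next
    case 2
    then have "sat (topstar_isotope a b) 1 1 1"
      using sat by (intro sat_222_imp_111 surj_sq_isotope(2) unit) auto
    then show ?thesis using 2 * by blast
  next
    case 3
    then show ?thesis using no [OF unit] sat pqr by blast
  next
    case 4
    have "sat (topstar_isotope (qcnj b) (qcnj a)) r q p"
      using sat sat_opposite [of "topstar_isotope a b"] sat_isomorphic [OF isotope_opposite(2)] by blast
    then show ?thesis using no [of "qcnj b" "qcnj a" q] unit 4 pqr by auto
  qed
qed

lemma lstar_isotope_not_sat_1:
  assumes "norm a = 1" "norm b = 1" "q \<in> {1, 2}" "r \<in> {1, 2}"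
  shows "\<not> sat (lstar_isotope a b) 1 q r"
proof -
  obtain z s t where zst: "complex_parameter z s t"
    and iso: "alg_isomorphic (lstar_isotope a b) (lstar_isotope (cq z 0) (cq s t))"
    using complex_parameter_exists [OF assms(1,2)] by metis
  show ?thesis
    using assms(3,4) sat_isomorphic [OF iso] complex_parameter.lstar_isotope_111 [OF zst]
      complex_parameter.lstar_isotope_112 [OF zst] complex_parameter.lstar_isotope_121 [OF zst]
      complex_parameter.lstar_isotope_122 [OF zst] by auto
qed

text \<open>Replacing \<open>s\<close> by its negative turns the angle by pi without changing the
  algebra, so half of the circle suffices.\<close>

lemma lstar_isotope_1_complex:
  assumes "s * cnj s = 1"
  shows "\<exists>\<alpha>\<in>{0..<pi}. alg_isomorphic (lstar_isotope 1 (cq s 0)) (lstar_isotope 1 (qcis \<alpha>))"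
proof -
  define \<theta> where "\<theta> = Arg s"
  have "norm (cq s 0) = 1" using assms by (simp add: cq_unit)
  then have "cmod s = 1" by (simp add: norm_quat_def cq_def cmod_def)
  then have \<theta>: "s = cis \<theta>" "- pi < \<theta>" "\<theta> \<le> pi"
    using rcis_cmod_Arg [of s] Arg_bounded [of s] by (auto simp: \<theta>_def rcis_def)
  have s: "cq s 0 = qcis \<theta>" by (simp add: \<theta> cq_def qcis_eq_Quat)
  have neg: "alg_isomorphic (lstar_isotope 1 (- x)) (lstar_isotope 1 x)" for x
    using isotope_sign(3) [of 1 "- 1" 1 x] by simp
  consider "0 \<le> \<theta>" "\<theta> < pi" | "\<theta> < 0" | "\<theta> = pi" using \<theta>(3) by linarith
  then show ?thesis
  proof cases
    case 1
    then show ?thesis using alg_isomorphic_refl [of "lstar_isotope 1 (qcis \<theta>)"] s by auto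
  next
    case 2
    have "qcis \<theta> = - qcis (\<theta> + pi)" by (simp add: qcis_eq_Quat uminus_quat_def)
    then show ?thesis using neg [of "qcis (\<theta> + pi)"] s 2 \<theta>(2) by (intro bexI [of _ "\<theta> + pi"]) auto
  next
    \<comment> \<open>The endpoint pi lies outside the half-open interval and is sent to 0.\<close>
    case 3
    have "qcis \<theta> = - qcis 0" by (simp add: 3 qcis_eq_Quat uminus_quat_def)
    then show ?thesis using neg [of "qcis 0"] s by (intro bexI [of _ 0]) auto
  qed
qed

lemma lstar_isotope_classification:
  assumes unit: "norm a = 1" "norm b = 1"
  shows "sat (lstar_isotope a b) 2 1 1 \<Longrightarrow> alg_isomorphic (lstar_isotope a b) lstar_mult"
    "sat (lstar_isotope a b) 2 2 1 \<Longrightarrow> alg_isomorphic (lstar_isotope a b) lstar_mult \<or>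
      alg_isomorphic (lstar_isotope a b) (lstar_isotope qi 1)"
    "sat (lstar_isotope a b) 2 1 2 \<Longrightarrow>
      \<exists>\<alpha>\<in>{0..<pi}. alg_isomorphic (lstar_isotope a b) (lstar_isotope 1 (qcis \<alpha>))"
    "sat (lstar_isotope a b) 2 2 2 \<Longrightarrow>
      alg_isomorphic (lstar_isotope a b) (lstar_isotope qi 1) \<or>
      alg_isomorphic (lstar_isotope a b) (lstar_isotope qi qi) \<or>
      (\<exists>\<alpha>\<in>{0..<pi}. alg_isomorphic (lstar_isotope a b) (lstar_isotope 1 (qcis \<alpha>)))"
proof -
  obtain z s t where zst: "complex_parameter z s t"
    and iso: "alg_isomorphic (lstar_isotope a b) (lstar_isotope (cq z 0) (cq s t))"
    using complex_parameter_exists [OF unit] by metis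
  note sat = sat_isomorphic [OF iso] and trans = alg_isomorphic_trans [OF iso]
  have sign: "alg_isomorphic (lstar_isotope x y) (lstar_isotope x' y')"
    if "x = x' \<or> x = - x'" "y = y' \<or> y = - y'" for x y x' y'
    using that isotope_sign(3) [of 1 1 x' y'] isotope_sign(3) [of 1 "- 1" x' y']
      isotope_sign(3) [of "- 1" 1 x' y'] isotope_sign(3) [of "- 1" "- 1" x' y']
    by auto
  show "alg_isomorphic (lstar_isotope a b) lstar_mult" if "sat (lstar_isotope a b) 2 1 1"
    using complex_parameter.lstar_isotope_211 [OF zst] that sat
      trans [OF sign [of "cq z 0" 1 "cq s t" 1]]
    by (auto simp: cq_1 cq_minus_1 isotope_1)
  show "alg_isomorphic (lstar_isotope a b) lstar_mult \<or>
      alg_isomorphic (lstar_isotope a b) (lstar_isotope qi 1)" if "sat (lstar_isotope a b) 2 2 1"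
    using complex_parameter.lstar_isotope_221 [OF zst] that sat
      trans [OF sign [of "cq z 0" 1 "cq s t" 1]] trans [OF sign [of "cq z 0" qi "cq s t" 1]]
    by (auto simp: cq_1 cq_minus_1 cq_i isotope_1)
  \<comment> \<open>The first parameter is 1 or -1 here, hence central, so a second conjugation can
    make the other one complex without disturbing it.\<close>
  have real: "\<exists>\<alpha>\<in>{0..<pi}. alg_isomorphic (lstar_isotope a b) (lstar_isotope 1 (qcis \<alpha>))"
    if z: "z = 1 \<or> z = - 1"
  proof -
    have b': "norm (cq s t) = 1" using zst by (simp add: cq_unit complex_parameter_def)
    obtain u where u: "norm u = 1" "qim2 (qcnj u * cq s t * u) = 0" "qim3 (qcnj u * cq s t * u) = 0"
      by (rule unit_conjugate_complex)
    obtain w where w: "qcnj u * cq s t * u = cq w 0"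
      using u(2,3) by (metis cq_def complex.sel zero_complex.sel quat.exhaust_sel)
    have "norm (cq w 0) = 1" using b' u(1) by (simp add: norm_quat_mult flip: w)
    then have "w * cnj w = 1" by (simp add: cq_unit)
    then obtain \<alpha> where \<alpha>: "\<alpha> \<in> {0..<pi}" "alg_isomorphic (lstar_isotope 1 (cq w 0)) (lstar_isotope 1 (qcis \<alpha>))"
      using lstar_isotope_1_complex by blast
    have "alg_isomorphic (lstar_isotope 1 (cq s t)) (lstar_isotope 1 (cq w 0))"
      using isotope_conjugate(3) [OF u(1), of 1 "cq s t"] u(1) by (simp add: w unit_cancel)
    moreover have "alg_isomorphic (lstar_isotope a b) (lstar_isotope 1 (cq s t))"
      using trans [OF sign [of "cq z 0" 1 "cq s t" "cq s t"]] z by (auto simp: cq_1 cq_minus_1)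
    ultimately show ?thesis using \<alpha> alg_isomorphic_trans by blast
  qed
  show "\<exists>\<alpha>\<in>{0..<pi}. alg_isomorphic (lstar_isotope a b) (lstar_isotope 1 (qcis \<alpha>))"
    if "sat (lstar_isotope a b) 2 1 2"
    using real complex_parameter.lstar_isotope_212 [OF zst] that sat by blast
  show "alg_isomorphic (lstar_isotope a b) (lstar_isotope qi 1) \<or>
      alg_isomorphic (lstar_isotope a b) (lstar_isotope qi qi) \<or>
      (\<exists>\<alpha>\<in>{0..<pi}. alg_isomorphic (lstar_isotope a b) (lstar_isotope 1 (qcis \<alpha>)))"
    if "sat (lstar_isotope a b) 2 2 2"
  proof -
    have "z = 1 \<or> z = - 1 \<or>
        (z = \<i> \<or> z = - \<i>) \<and> t = 0 \<and> (s = 1 \<or> s = - 1 \<or> s = \<i> \<or> s = - \<i>)"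
      using complex_parameter.lstar_isotope_222 [OF zst] that sat by blast
    then show ?thesis
      using real trans [OF sign [of "cq z 0" qi "cq s t" 1]] trans [OF sign [of "cq z 0" qi "cq s t" qi]]
      by (elim disjE conjE) (simp_all add: cq_1 cq_minus_1 cq_i)
  qed
qed

text \<open>\<open>lstar_isotope\<close> satisfies no identity with first exponent 1; through the
  opposite product this bars last exponent 1 for \<open>rstar_isotope\<close>. Together with p = r
  for \<open>topstar_isotope\<close>, this sorts the families over the eight identities.\<close>

lemma normal_form_sat:
  fixes m :: "'a::real_vector \<Rightarrow> 'a \<Rightarrow> 'a"
  assumes "dim (UNIV :: 'a set) = 4" "absolute_valued m" "sat m p q r"
    and pqr: "p \<in> {1, 2}" "q \<in> {1, 2}" "r \<in> {1, 2}"
  obtains "alg_isomorphic m ((*) :: quat \<Rightarrow> quat \<Rightarrow> quat)"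
  | "p = r" "alg_isomorphic m topstar_mult"
  | a b where "p = 2" "norm a = 1" "norm b = 1" "alg_isomorphic m (lstar_isotope a b)"
      "sat (lstar_isotope a b) p q r"
  | a b where "r = 2" "norm a = 1" "norm b = 1"
      "alg_isomorphic (\<lambda>x y. m y x) (lstar_isotope a b)" "sat (lstar_isotope a b) r q p"
proof -
  obtain a b where ab: "norm a = 1" "norm b = 1" and
    "alg_isomorphic m (id_isotope a b) \<or> alg_isomorphic m (topstar_isotope a b) \<or>
     alg_isomorphic m (lstar_isotope a b) \<or> alg_isomorphic m (rstar_isotope a b)"
    by (rule absolute_valued_normal_form [OF assms(1,2)])
  then consider "alg_isomorphic m (id_isotope a b)" | "alg_isomorphic m (topstar_isotope a b)" |
    "alg_isomorphic m (lstar_isotope a b)" | "alg_isomorphic m (rstar_isotope a b)"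
    by blast
  then show thesis
  proof cases
    case 1
    then have "sat (id_isotope a b) p q r" using assms(3) sat_isomorphic by blast
    from id_isotope_classification [OF ab this pqr] show thesis
      using that(1) 1 alg_isomorphic_trans by blast
  next
    case 2
    then have "sat (topstar_isotope a b) p q r" using assms(3) sat_isomorphic by blast
    from topstar_isotope_classification [OF ab this pqr] show thesis
      using that(2) 2 alg_isomorphic_trans by blast
  next
    case 3
    then have s: "sat (lstar_isotope a b) p q r" using assms(3) sat_isomorphic by blast
    then have "p = 2" using lstar_isotope_not_sat_1 [OF ab pqr(2,3)] pqr(1) by auto
    then show thesis using that(3) ab 3 s by blast
  next
    case 4
    have iso: "alg_isomorphic (\<lambda>x y. m y x) (lstar_isotope (qcnj b) (qcnj a))"
      by (rule alg_isomorphic_trans [OF iffD1 [OF alg_isomorphic_opposite 4] isotope_opposite(4)])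
    have "sat (\<lambda>x y. m y x) r q p" using assms(3) sat_opposite [of m r q p] by simp
    then have s: "sat (lstar_isotope (qcnj b) (qcnj a)) r q p"
      using sat_isomorphic [OF iso] by blast
    then have "r = 2"
      using lstar_isotope_not_sat_1 [of "qcnj b" "qcnj a" q p] ab pqr by auto
    then show thesis using that(4) [OF _ _ _ iso s] ab by simp
  qed
qed

text \<open>The conjugate of e^(i alpha) is - e^(i (pi - alpha)). For alpha = 0 that angle would
  leave the interval, but 1 is its own conjugate.\<close>

lemma qcnj_qcis_sign:
  assumes "\<alpha> \<in> {0..<pi}"
  obtains \<beta> where "\<beta> \<in> {0..<pi}" "qcnj (qcis \<alpha>) = qcis \<beta> \<or> qcnj (qcis \<alpha>) = - qcis \<beta>"
proof (cases "\<alpha> = 0")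
  case True
  then show thesis using assms by (intro that [of 0]) (simp_all add: qcis_eq_Quat qcnj_def)
next
  case False
  then show thesis
    using assms by (intro that [of "pi - \<alpha>"]) (auto simp: qcis_eq_Quat qcnj_def uminus_quat_def)
qed

section \<open>The identities hold in the listed algebras\<close>

lemma sat_mult: "sat ((*) :: quat \<Rightarrow> quat \<Rightarrow> quat) p q r"
  by (simp add: sat_def associator_def mult.assoc)

lemma scaleR_qcnj_mult_self:
  "qcnj x * x = (norm x)\<^sup>2 *\<^sub>R 1" "x * qcnj x = (norm x)\<^sup>2 *\<^sub>R 1"
  "qcnj x * (x * y) = (norm x)\<^sup>2 *\<^sub>R y" "x * (qcnj x * y) = (norm x)\<^sup>2 *\<^sub>R y"
  using qcnj_mult_self [of x]
  by (simp_all add: of_real_def flip: mult.assoc)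

lemma sat_topstar_mult: "p = r \<Longrightarrow> sat topstar_mult p q r"
  using topstar_isotope_associator [of 1 1]
  by (auto simp: sat_def isotope_1 pw_def sq_def topstar_mult_def mult.assoc scaleR_qcnj_mult_self)

text \<open>Squares are real multiples of \<open>b\<close>, and with outer entries \<open>b\<close>
  both sides of \<open>lstar_isotope_associator\<close> are the same word.\<close>

lemma sat_lstar_1:
  assumes "norm b = 1"
  shows "sat (lstar_isotope 1 b) 2 q 2"
proof -
  have "sq (lstar_isotope 1 b) x = (norm x)\<^sup>2 *\<^sub>R b" for x
    by (simp add: sq_def lstar_isotope_def scaleR_qcnj_mult_self)
  then show ?thesis
    using assms lstar_isotope_associator [of 1 b]
    by (simp add: sat_def pw_def mult.assoc unit_cancel)
qed

lemma sat_lstar_mult: "sat lstar_mult 2 q r"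
proof -
  have "sq lstar_mult x = (norm x)\<^sup>2 *\<^sub>R 1" for x
    by (simp add: sq_def lstar_mult_def scaleR_qcnj_mult_self)
  then show ?thesis
    by (simp add: sat_def pw_def associator_def lstar_mult_def mult.assoc)
qed

lemma qcnj_qi: "qcnj qi = - qi"
  by (simp add: qcnj_def qi_def uminus_quat_def)

lemma qi_mult_cancel: "qi * (qi * x) = - x"
  by (simp add: quat_basis_mult flip: mult.assoc)

text \<open>Squares conj(x) i x are purely imaginary, as is the parameter; with equal first two
  entries each side of the associator equation carries two signs, and they cancel.\<close>

lemma sat_lstar_qi_1: "sat (lstar_isotope qi 1) 2 2 r"
proof -
  have "qcnj (sq (lstar_isotope qi 1) x) = - sq (lstar_isotope qi 1) x" for x
    by (simp add: sq_def lstar_isotope_def qcnj_qi mult.assoc)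
  then show ?thesis
    using lstar_isotope_associator [of qi 1]
    by (simp add: sat_def pw_def qcnj_qi)
qed

lemma sat_lstar_qi_qi: "sat (lstar_isotope qi qi) 2 2 2"
  unfolding sat_def
proof
  fix x
  \<comment> \<open>Every square is g i with g purely imaginary, so g^2 is a real scalar.\<close>
  define g where "g = qcnj x * qi * x"
  have g: "qcnj g = - g" by (simp add: g_def qcnj_qi mult.assoc)
  have gg: "g * (g * y) = - ((norm g)\<^sup>2 *\<^sub>R y)" for y
    using scaleR_qcnj_mult_self(3) [of g y] by (simp add: g) (metis minus_minus)
  have "pw (lstar_isotope qi qi) 2 x = g * qi"
    by (simp add: pw_def sq_def lstar_isotope_def g_def)
  then show "associator (lstar_isotope qi qi) (pw (lstar_isotope qi qi) 2 x)
      (pw (lstar_isotope qi qi) 2 x) (pw (lstar_isotope qi qi) 2 x) = 0"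
    by (simp add: lstar_isotope_associator qcnj_qi g mult.assoc qi_mult_cancel gg)
qed

lemma opposite_lstar_isotope:
  assumes "alg_isomorphic (\<lambda>x y. m y x) (lstar_isotope a b)"
  shows "alg_isomorphic m (rstar_isotope (qcnj b) (qcnj a))"
  by (rule alg_isomorphic_opposite_trans [OF assms isotope_opposite(3)])

text \<open>Conjugating the parameters i and e^(i alpha) leads out of the list;
  \<open>isotope_sign\<close> brings them back.\<close>

lemma opposite_lstar:
  "alg_isomorphic (\<lambda>x y. m y x) lstar_mult \<Longrightarrow> alg_isomorphic m rstar_mult"
  "alg_isomorphic (\<lambda>x y. m y x) (lstar_isotope qi 1) \<Longrightarrow> alg_isomorphic m (rstar_isotope 1 qi)"
  "alg_isomorphic (\<lambda>x y. m y x) (lstar_isotope qi qi) \<Longrightarrow> alg_isomorphic m (rstar_isotope qi qi)"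
  "\<exists>\<alpha>\<in>{0..<pi}. alg_isomorphic (\<lambda>x y. m y x) (lstar_isotope 1 (qcis \<alpha>)) \<Longrightarrow>
    \<exists>\<alpha>\<in>{0..<pi}. alg_isomorphic m (rstar_isotope (qcis \<alpha>) 1)"
proof -
  note sign = isotope_sign(4)
  show "alg_isomorphic m rstar_mult" if "alg_isomorphic (\<lambda>x y. m y x) lstar_mult"
    using opposite_lstar_isotope [of m 1 1] that by (simp add: isotope_1)
  show "alg_isomorphic m (rstar_isotope 1 qi)" if "alg_isomorphic (\<lambda>x y. m y x) (lstar_isotope qi 1)"
    using alg_isomorphic_trans [OF opposite_lstar_isotope [OF that]] sign [of 1 "- 1" 1 qi]
    by (simp add: qcnj_qi)
  show "alg_isomorphic m (rstar_isotope qi qi)" if "alg_isomorphic (\<lambda>x y. m y x) (lstar_isotope qi qi)"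
    using alg_isomorphic_trans [OF opposite_lstar_isotope [OF that]] sign [of "- 1" "- 1" qi qi]
    by (simp add: qcnj_qi)
  assume "\<exists>\<alpha>\<in>{0..<pi}. alg_isomorphic (\<lambda>x y. m y x) (lstar_isotope 1 (qcis \<alpha>))"
  then obtain \<alpha> where \<alpha>: "\<alpha> \<in> {0..<pi}" "alg_isomorphic m (rstar_isotope (qcnj (qcis \<alpha>)) 1)"
    using opposite_lstar_isotope by fastforce
  obtain \<beta> where \<beta>: "\<beta> \<in> {0..<pi}" "qcnj (qcis \<alpha>) = qcis \<beta> \<or> qcnj (qcis \<alpha>) = - qcis \<beta>"
    by (rule qcnj_qcis_sign [OF \<alpha>(1)])
  have "alg_isomorphic (rstar_isotope (qcnj (qcis \<alpha>)) 1) (rstar_isotope (qcis \<beta>) 1)"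
    using \<beta>(2) sign [of 1 1 "qcis \<beta>" 1] sign [of "- 1" 1 "qcis \<beta>" 1] by auto
  then show "\<exists>\<alpha>\<in>{0..<pi}. alg_isomorphic m (rstar_isotope (qcis \<alpha>) 1)"
    using \<beta>(1) alg_isomorphic_trans [OF \<alpha>(2)] by blast
qed

lemma sat_rstar_isotope:
  "sat (rstar_isotope a b) p q r \<longleftrightarrow> sat (lstar_isotope (qcnj b) (qcnj a)) r q p"
  using sat_opposite [of "rstar_isotope a b" r q p] sat_isomorphic [OF isotope_opposite(4), of a b]
  by simp

lemma sat_rstar:
  "sat rstar_mult p q 2" "sat (rstar_isotope 1 qi) p 2 2" "sat (rstar_isotope qi qi) 2 2 2"
  "norm a = 1 \<Longrightarrow> sat (rstar_isotope a 1) 2 q 2"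
proof -
  have neg: "sat (lstar_isotope (- qi) 1) p q r \<longleftrightarrow> sat (lstar_isotope qi 1) p q r"
    "sat (lstar_isotope (- qi) (- qi)) p q r \<longleftrightarrow> sat (lstar_isotope qi qi) p q r" for p q r
    using sat_isomorphic [OF isotope_sign(3) [of "- 1" 1 qi 1]]
      sat_isomorphic [OF isotope_sign(3) [of "- 1" "- 1" qi qi]] by simp_all
  show "sat rstar_mult p q 2"
    using sat_rstar_isotope [of 1 1] sat_lstar_mult by (simp add: isotope_1)
  show "sat (rstar_isotope 1 qi) p 2 2"
    by (simp add: sat_rstar_isotope qcnj_qi neg sat_lstar_qi_1)
  show "sat (rstar_isotope qi qi) 2 2 2"
    by (simp add: sat_rstar_isotope qcnj_qi neg sat_lstar_qi_qi)
  show "sat (rstar_isotope a 1) 2 q 2" if "norm a = 1"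
    using that by (simp add: sat_rstar_isotope sat_lstar_1)
qed

theorem theorem3p24:
  fixes m :: "'a::real_vector \<Rightarrow> 'a \<Rightarrow> 'a"
  assumes dim4: "dim (UNIV :: 'a set) = 4"
    and av: "absolute_valued m"
  shows
    "((\<forall>x. associator m x x x = 0) \<longleftrightarrow>
        alg_isomorphic m ((*) :: quat \<Rightarrow> quat \<Rightarrow> quat) \<or> alg_isomorphic m topstar_mult) \<and>
     ((\<forall>x. associator m x (sq m x) x = 0) \<longleftrightarrow>
        alg_isomorphic m ((*) :: quat \<Rightarrow> quat \<Rightarrow> quat) \<or> alg_isomorphic m topstar_mult) \<and>
     ((\<forall>x. associator m x x (sq m x) = 0) \<longleftrightarrow>
        alg_isomorphic m ((*) :: quat \<Rightarrow> quat \<Rightarrow> quat) \<or> alg_isomorphic m rstar_mult) \<and>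
     ((\<forall>x. associator m x (sq m x) (sq m x) = 0) \<longleftrightarrow>
        alg_isomorphic m ((*) :: quat \<Rightarrow> quat \<Rightarrow> quat) \<or> alg_isomorphic m rstar_mult \<or>
        alg_isomorphic m (rstar_isotope 1 qi)) \<and>
     ((\<forall>x. associator m (sq m x) x x = 0) \<longleftrightarrow>
        alg_isomorphic m ((*) :: quat \<Rightarrow> quat \<Rightarrow> quat) \<or> alg_isomorphic m lstar_mult) \<and>
     ((\<forall>x. associator m (sq m x) (sq m x) x = 0) \<longleftrightarrow>
        alg_isomorphic m ((*) :: quat \<Rightarrow> quat \<Rightarrow> quat) \<or> alg_isomorphic m lstar_mult \<or>
        alg_isomorphic m (lstar_isotope qi 1)) \<and>
     ((\<forall>x. associator m (sq m x) x (sq m x) = 0) \<longleftrightarrow>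
        alg_isomorphic m ((*) :: quat \<Rightarrow> quat \<Rightarrow> quat) \<or> alg_isomorphic m topstar_mult \<or>
        (\<exists>\<alpha>\<in>{0..<pi}. alg_isomorphic m (lstar_isotope 1 (qcis \<alpha>)) \<or>
                      alg_isomorphic m (rstar_isotope (qcis \<alpha>) 1))) \<and>
     ((\<forall>x. associator m (sq m x) (sq m x) (sq m x) = 0) \<longleftrightarrow>
        alg_isomorphic m ((*) :: quat \<Rightarrow> quat \<Rightarrow> quat) \<or> alg_isomorphic m topstar_mult \<or>
        alg_isomorphic m (lstar_isotope qi 1) \<or> alg_isomorphic m (lstar_isotope qi qi) \<or>
        alg_isomorphic m (rstar_isotope 1 qi) \<or> alg_isomorphic m (rstar_isotope qi qi) \<or>
        (\<exists>\<alpha>\<in>{0..<pi}. alg_isomorphic m (lstar_isotope 1 (qcis \<alpha>)) \<or>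
                      alg_isomorphic m (rstar_isotope (qcis \<alpha>) 1)))"
proof -
  let ?H = "(*) :: quat \<Rightarrow> quat \<Rightarrow> quat"
  note form = normal_form_sat [OF dim4 av]
  note iso = sat_isomorphic [of m]
  note cls = lstar_isotope_classification
  have trans: "alg_isomorphic k n \<Longrightarrow> alg_isomorphic n n' \<Longrightarrow> alg_isomorphic k n'"
    for k :: "'a \<Rightarrow> 'a \<Rightarrow> 'a" and n n' :: "quat \<Rightarrow> quat \<Rightarrow> quat"
    by (rule alg_isomorphic_trans)
  note sats = sat_mult sat_topstar_mult sat_lstar_mult sat_lstar_1 sat_lstar_qi_1
    sat_lstar_qi_qi sat_rstar
  have eq: "(\<forall>x. associator m x x x = 0) \<longleftrightarrow> sat m 1 1 1"
    "(\<forall>x. associator m x (sq m x) x = 0) \<longleftrightarrow> sat m 1 2 1"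
    "(\<forall>x. associator m x x (sq m x) = 0) \<longleftrightarrow> sat m 1 1 2"
    "(\<forall>x. associator m x (sq m x) (sq m x) = 0) \<longleftrightarrow> sat m 1 2 2"
    "(\<forall>x. associator m (sq m x) x x = 0) \<longleftrightarrow> sat m 2 1 1"
    "(\<forall>x. associator m (sq m x) (sq m x) x = 0) \<longleftrightarrow> sat m 2 2 1"
    "(\<forall>x. associator m (sq m x) x (sq m x) = 0) \<longleftrightarrow> sat m 2 1 2"
    "(\<forall>x. associator m (sq m x) (sq m x) (sq m x) = 0) \<longleftrightarrow> sat m 2 2 2"
    by (simp_all add: sat_def pw_def)
  have d: "(1 :: nat) \<in> {1, 2}" "(2 :: nat) \<in> {1, 2}" by simp_all
  \<comment> \<open>With both outer exponents 1 the last two cases of \<open>form\<close> are void,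
    since they demand p = 2 or r = 2.\<close>
  have 111: "alg_isomorphic m ?H \<or> alg_isomorphic m topstar_mult" if "sat m 1 q 1" "q \<in> {1, 2}" for q
    by (rule form [OF that(1) d(1) that(2) d(1)]) auto
  have 112: "alg_isomorphic m ?H \<or> alg_isomorphic m rstar_mult" if "sat m 1 1 2"
  proof (cases rule: form [OF that d(1) d(1) d(2)])
    case (4 a b)
    then show ?thesis using trans [OF 4(4)] cls(1) [OF 4(2,3)] opposite_lstar [of m] by blast
  qed auto
  have 122: "alg_isomorphic m ?H \<or> alg_isomorphic m rstar_mult \<or>
      alg_isomorphic m (rstar_isotope 1 qi)" if "sat m 1 2 2"
  proof (cases rule: form [OF that d(1) d(2) d(2)])
    case (4 a b)
    then show ?thesis using trans [OF 4(4)] cls(2) [OF 4(2,3)] opposite_lstar [of m] by blast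
  qed auto
  have 211: "alg_isomorphic m ?H \<or> alg_isomorphic m lstar_mult" if "sat m 2 1 1"
  proof (cases rule: form [OF that d(2) d(1) d(1)])
    case (3 a b)
    then show ?thesis using trans [OF 3(4)] cls(1) [OF 3(2,3)] by blast
  qed auto
  have 221: "alg_isomorphic m ?H \<or> alg_isomorphic m lstar_mult \<or>
      alg_isomorphic m (lstar_isotope qi 1)" if "sat m 2 2 1"
  proof (cases rule: form [OF that d(2) d(2) d(1)])
    case (3 a b)
    then show ?thesis using trans [OF 3(4)] cls(2) [OF 3(2,3)] by blast
  qed auto
  have 212: "alg_isomorphic m ?H \<or> alg_isomorphic m topstar_mult \<or>
        (\<exists>\<alpha>\<in>{0..<pi}. alg_isomorphic m (lstar_isotope 1 (qcis \<alpha>)) \<or>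
                      alg_isomorphic m (rstar_isotope (qcis \<alpha>) 1))" if "sat m 2 1 2"
  proof (cases rule: form [OF that d(2) d(1) d(2)])
    case (3 a b)
    then show ?thesis using trans [OF 3(4)] cls(3) [OF 3(2,3)] by blast
  next
    case (4 a b)
    then show ?thesis using trans [OF 4(4)] cls(3) [OF 4(2,3)] opposite_lstar(4) [of m] by blast
  qed auto
  have 222: "alg_isomorphic m ?H \<or> alg_isomorphic m topstar_mult \<or>
        alg_isomorphic m (lstar_isotope qi 1) \<or> alg_isomorphic m (lstar_isotope qi qi) \<or>
        alg_isomorphic m (rstar_isotope 1 qi) \<or> alg_isomorphic m (rstar_isotope qi qi) \<or>
        (\<exists>\<alpha>\<in>{0..<pi}. alg_isomorphic m (lstar_isotope 1 (qcis \<alpha>)) \<or>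
                      alg_isomorphic m (rstar_isotope (qcis \<alpha>) 1))" if "sat m 2 2 2"
  proof (cases rule: form [OF that d(2) d(2) d(2)])
    case (3 a b)
    then show ?thesis using trans [OF 3(4)] cls(4) [OF 3(2,3)] by blast
  next
    case (4 a b)
    then show ?thesis using trans [OF 4(4)] cls(4) [OF 4(2,3)] opposite_lstar [of m] by blast
  qed auto
  show ?thesis
    unfolding eq
  proof (intro conjI iffI)
  qed (use 111 [of 1] 111 [of 2] 112 122 211 221 212 222 in \<open>auto simp: iso sats\<close>)
qed

end
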